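(* If a feedback encoding scheme $\Psi=(e_n:\mathsf W\times\mathsf Y^{n-1}\to\mathsf X)_{n\ge1}$ is reliable, then $$\lim_{n\to\infty}\mathbb E_\nu\big[\|\psi_n-\bar\psi_n\|\big]=0$$ for any probability measure $\nu\ll\bar\nu$ on $\mathsf W$.
   Context: $\mathsf W,\mathsf X\subset\mathbb R^d$ and $\mathsf Y$ are (subsets of) Euclidean spaces with Borel $\sigma$-algebras; $\mathsf W$ is open, bounded and convex. $\bar\nu$ is the uniform distribution on $\mathsf W$. $P_{Y|X}$ is a transition kernel from $\mathsf X$ to $\mathsf Y$. An encoding scheme is a sequence of measurable maps $e_n:\mathsf W\times\mathsf Y^{n-1}\to\mathsf X$, $n\ge1$; with message point $W$, the channel inputs are $X_n=e_n(W,Y_1,\dots,Y_{n-1})$, and the outputs $Y_n$ come from a time-invariant memoryless channel: the conditional law of $Y_n$ given $\sigma(W,X_{1:n},Y_{1:n-1})$ is $P_{Y|X}(\cdot|X_n)$. On a common measurable space $(\Omega,\mathcal F)$ carrying $(W,(X_n),(Y_n))$, $\overline{\mathbb P}$ is the law with $W\sim\bar\nu$ and $\mathbb P=\mathbb P_\nu$ is the law with $W\sim\nu$ (same scheme and channel); $\mathbb E_\nu$ is expectation under $\mathbb P_\nu$. Let $\mathcal F^Y_{1:n}=\sigma(Y_1,\dots,Y_n)$ and $\mathcal F^Y_{1:\infty}=\sigma(Y_1,Y_2,\dots)$. The posteriors are (regular versions of) $\psi_n(A)=\mathbb P_\nu(W\in A\mid\mathcal F^Y_{1:n})$ and $\bar\psi_n(A)=\overline{\mathbb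 P}(W\in A\mid\mathcal F^Y_{1:n})$. Total variation: $\|P-Q\|=\sup_A|P(A)-Q(A)|$. The scheme is reliable if $W$ is $\mathcal F^Y_{1:\infty}$-measurable $\overline{\mathbb P}$-a.s. (i.e. equals $\overline{\mathbb P}$-a.s. an $\mathcal F^Y_{1:\infty}$-measurable random variable). *)

theory Defs
  imports "HOL-Probability.Probability"
begin

abbreviation borel_on :: "'a::topological_space set \<Rightarrow> 'a measure" where
  "borel_on S \<equiv> restrict_space borel S"

definition uniform_on :: "'a::euclidean_space set \<Rightarrow> 'a measure" where
  "uniform_on S = uniform_measure (restrict_space lborel S) S"

definition tv_dist :: "'a measure \<Rightarrow> 'a measure \<Rightarrow> real" where
  "tv_dist P Q = (SUP A\<in>sets P. \<bar>measure P A - measure Q A\<bar>)"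

definition transition_kernel :: "'x measure \<Rightarrow> 'y measure \<Rightarrow> ('x \<Rightarrow> 'y measure) \<Rightarrow> bool" where
  "transition_kernel S T \<kappa> \<longleftrightarrow> \<kappa> \<in> S \<rightarrow>\<^sub>M prob_algebra T"

text \<open>
  A regular version of the conditional distribution of \<open>Z\<close> (with values in \<open>S\<close>) given the
  sub-sigma-algebra \<open>F\<close> of \<open>M\<close>.  The almost sure identity is taken with respect to \<open>M\<close>;
  \<open>F\<close> only contributes its measurable sets.
\<close>
definition regular_cond_distr ::
  "'o measure \<Rightarrow> 'o measure \<Rightarrow> ('o \<Rightarrow> 's) \<Rightarrow> 's measure \<Rightarrow> ('o \<Rightarrow> 's measure) \<Rightarrow> bool" where
  "regular_cond_distr M F Z S \<kappa> \<longleftrightarrow>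
     transition_kernel F S \<kappa> \<and>
     (\<forall>A\<in>sets S. AE \<omega> in M. measure (\<kappa> \<omega>) A = real_cond_exp M F (indicator (Z -` A \<inter> space M)) \<omega>)"

text \<open>
  Times start at 1; the value at index 0 of an encoder, input or output sequence is never used.
  A point of \<open>\<Y>\<^sup>n\<^sup>-\<^sup>1\<close> is a function on the index set \<open>{1..<n}\<close>, extensional as in \<^const>\<open>PiM\<close>.
\<close>
definition encoding_scheme ::
  "'w measure \<Rightarrow> 'x measure \<Rightarrow> 'y measure \<Rightarrow> (nat \<Rightarrow> 'w \<times> (nat \<Rightarrow> 'y) \<Rightarrow> 'x) \<Rightarrow> bool" where
  "encoding_scheme SW SX SY e \<longleftrightarrow>
     (\<forall>n\<ge>1. e n \<in> SW \<Otimes>\<^sub>M (\<Pi>\<^sub>M i\<in>{1..<n}. SY) \<rightarrow>\<^sub>M SX)"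

definition output_algebra :: "'o set \<Rightarrow> 'y measure \<Rightarrow> (nat \<Rightarrow> 'o \<Rightarrow> 'y) \<Rightarrow> nat set \<Rightarrow> 'o measure" where
  "output_algebra \<Omega> SY Y I = sigma \<Omega> (\<Union>i\<in>I. sets (vimage_algebra \<Omega> (Y i) SY))"

text \<open>\<open>\<sigma>(W, X\<^sub>1, \<dots>, X\<^sub>n, Y\<^sub>1, \<dots>, Y\<^sub>n\<^sub>-\<^sub>1)\<close>\<close>
definition history_algebra ::
  "'o set \<Rightarrow> 'w measure \<Rightarrow> 'x measure \<Rightarrow> 'y measure \<Rightarrow>
   ('o \<Rightarrow> 'w) \<Rightarrow> (nat \<Rightarrow> 'o \<Rightarrow> 'x) \<Rightarrow> (nat \<Rightarrow> 'o \<Rightarrow> 'y) \<Rightarrow> nat \<Rightarrow> 'o measure" where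
  "history_algebra \<Omega> SW SX SY W X Y n = sigma \<Omega>
     (sets (vimage_algebra \<Omega> W SW)
      \<union> (\<Union>i\<in>{1..n}. sets (vimage_algebra \<Omega> (X i) SX))
      \<union> (\<Union>i\<in>{1..<n}. sets (vimage_algebra \<Omega> (Y i) SY)))"

text \<open>
  The probability measure \<open>M\<close> is a law of the message point \<open>W\<close>, inputs \<open>X\<close> and outputs \<open>Y\<close>
  when a message distributed as \<open>\<mu>\<close> is sent with the scheme \<open>e\<close> over the time-invariant memoryless
  channel \<open>K\<close> with feedback.
\<close>
definition feedback_law ::
  "'w measure \<Rightarrow> 'x measure \<Rightarrow> 'y measure \<Rightarrow> ('x \<Rightarrow> 'y measure) \<Rightarrow>
   (nat \<Rightarrow> 'w \<times> (nat \<Rightarrow> 'y) \<Rightarrow> 'x) \<Rightarrow> ('o \<Rightarrow> 'w) \<Rightarrow> (nat \<Rightarrow> 'o \<Rightarrow> 'x) \<Rightarrow> (nat \<Rightarrow> 'o \<Rightarrow> 'y) \<Rightarrow>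
   'w measure \<Rightarrow> 'o measure \<Rightarrow> bool" where
  "feedback_law SW SX SY K e W X Y \<mu> M \<longleftrightarrow>
     prob_space M \<and>
     W \<in> M \<rightarrow>\<^sub>M SW \<and> (\<forall>n\<ge>1. X n \<in> M \<rightarrow>\<^sub>M SX) \<and> (\<forall>n\<ge>1. Y n \<in> M \<rightarrow>\<^sub>M SY) \<and>
     distr M SW W = \<mu> \<and>
     (\<forall>n\<ge>1. \<forall>\<omega>\<in>space M. X n \<omega> = e n (W \<omega>, \<lambda>i\<in>{1..<n}. Y i \<omega>)) \<and>
     (\<forall>n\<ge>1. regular_cond_distr M (history_algebra (space M) SW SX SY W X Y n) (Y n) SY
               (\<lambda>\<omega>. K (X n \<omega>)))"

text \<open>
  Reliability of a scheme, expressed through a realisation of it: \<open>M\<close> has to be the law under the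
  uniformly distributed message.
\<close>
definition reliable ::
  "'w measure \<Rightarrow> 'y measure \<Rightarrow> ('o \<Rightarrow> 'w) \<Rightarrow> (nat \<Rightarrow> 'o \<Rightarrow> 'y) \<Rightarrow> 'o measure \<Rightarrow> bool" where
  "reliable SW SY W Y M \<longleftrightarrow>
     (\<exists>V \<in> output_algebra (space M) SY Y {1..} \<rightarrow>\<^sub>M SW. AE \<omega> in M. W \<omega> = V \<omega>)"

definition posterior ::
  "'w measure \<Rightarrow> 'y measure \<Rightarrow> ('o \<Rightarrow> 'w) \<Rightarrow> (nat \<Rightarrow> 'o \<Rightarrow> 'y) \<Rightarrow> 'o measure \<Rightarrow> nat \<Rightarrow>
   ('o \<Rightarrow> 'w measure) \<Rightarrow> bool" where
  "posterior SW SY W Y M n \<psi> \<longleftrightarrow>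
     regular_cond_distr M (output_algebra (space M) SY Y {1..n}) W SW \<psi>"

end

theory Submission
  imports Defs
begin

text \<open>
  Let \<open>f\<close> be the density of \<open>\<nu>\<close> with respect to the uniform distribution.  The channel is the
  same under both laws, so on \<open>\<sigma>(W, Y\<^sub>1, \<dots>, Y\<^sub>n)\<close> the law \<open>P\<close> has density \<open>f(W)\<close> with respect to
  \<open>Pbar\<close>.  Put \<open>Z\<^sub>n = \<integral>f d\<psi>bar\<^sub>n\<close>, the density on \<open>\<sigma>(Y\<^sub>1, \<dots>, Y\<^sub>n)\<close>.  Bayes' rule
  \<open>Z\<^sub>n \<psi>\<^sub>n(dw) = f(w) \<psi>bar\<^sub>n(dw)\<close> bounds \<open>Z\<^sub>n\<close> times the total variation distance by
  \<open>\<integral>|f - Z\<^sub>n| d\<psi>bar\<^sub>n\<close>, and integrating gives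
  \<open>E\<^sub>P[tv] \<le> Ebar|f(W) - Z\<^sub>n| \<le> 2 Ebar|f(W) - U|\<close> for every \<open>\<sigma>(Y\<^sub>1, \<dots>, Y\<^sub>n)\<close>-measurable \<open>U\<close>.
  By reliability \<open>f(W)\<close> is a.s. \<open>\<sigma>(Y\<^sub>1, Y\<^sub>2, \<dots>)\<close>-measurable, hence an \<open>L\<^sup>1\<close> limit of such \<open>U\<close>;
  this replaces martingale convergence.
\<close>

section \<open>Integration against a regular conditional distribution\<close>

text \<open>The joint law of \<open>\<omega>\<close>, seen through \<open>F\<close>, and
  \<open>Z\<close> is the composition of \<open>M\<close> restricted to \<open>F\<close> with the
  kernel \<open>\<kappa>\<close>. The a.s. identities defining \<open>\<kappa>\<close> say this on
  rectangles, and a pi-system argument extends it to the product sigma-algebra. Letting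
  \<open>g\<close> depend on \<open>\<omega>\<close> allows past observations to be held fixed while
  \<open>Z\<close> is integrated out.\<close>

lemma nn_integral_regular_cond_distr:
  assumes "prob_space M" and sub: "subalgebra M F" and Z[measurable]: "Z \<in> M \<rightarrow>\<^sub>M S"
    and \<kappa>: "regular_cond_distr M F Z S \<kappa>"
    and g[measurable]: "case_prod g \<in> borel_measurable (F \<Otimes>\<^sub>M S)"
  shows "(\<integral>\<^sup>+\<omega>. g \<omega> (Z \<omega>) \<partial>M) = (\<integral>\<^sup>+\<omega>. \<integral>\<^sup>+z. g \<omega> z \<partial>\<kappa> \<omega> \<partial>M)"
proof -
  interpret prob_space M by fact
  interpret finite_measure_subalgebra M F by unfold_locales (fact sub)
  have spF: "space F = space M" and sF: "sets F \<subseteq> sets M"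
    using sub by (auto simp: subalgebra_def)
  have id[measurable]: "(\<lambda>x. x) \<in> M \<rightarrow>\<^sub>M F"
    using sub by (rule measurable_from_subalg) simp
  have k[measurable]: "\<kappa> \<in> F \<rightarrow>\<^sub>M prob_algebra S"
    using \<kappa> by (simp add: regular_cond_distr_def transition_kernel_def)
  have ks[measurable]: "\<kappa> \<in> F \<rightarrow>\<^sub>M subprob_algebra S" by (rule measurable_prob_algebraD) fact
  have kp: "prob_space (\<kappa> \<omega>)" "sets (\<kappa> \<omega>) = sets S" if "\<omega> \<in> space M" for \<omega>
    using measurable_space[OF k, of \<omega>] that by (auto simp: spF space_prob_algebra)
  \<comment> \<open>This is \<open>M\<close> restricted to \<open>F\<close>, written as an image
    under the identity. The kernel is measurable with respect to \<open>F\<close>, so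
    \<open>MF\<close> is the right base for the bind in \<open>D2\<close>.\<close>
  define MF where "MF = distr M F (\<lambda>x. x)"
  have sMF[measurable_cong]: "sets MF = sets F" by (simp add: MF_def)
  define D1 where "D1 = distr M (F \<Otimes>\<^sub>M S) (\<lambda>\<omega>. (\<omega>, Z \<omega>))"
  define D2 where "D2 = MF \<bind> (\<lambda>\<omega>. distr (\<kappa> \<omega>) (F \<Otimes>\<^sub>M S) (Pair \<omega>))"
  have ne: "space MF \<noteq> {}" using not_empty by (simp add: MF_def spF)
  have kk: "(\<lambda>\<omega>. distr (\<kappa> \<omega>) (F \<Otimes>\<^sub>M S) (Pair \<omega>)) \<in> F \<rightarrow>\<^sub>M subprob_algebra (F \<Otimes>\<^sub>M S)"
    by (rule measurable_distr2[OF _ ks]) simp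
  then have kk': "(\<lambda>\<omega>. distr (\<kappa> \<omega>) (F \<Otimes>\<^sub>M S) (Pair \<omega>)) \<in> MF \<rightarrow>\<^sub>M subprob_algebra (F \<Otimes>\<^sub>M S)"
    by (simp cong: measurable_cong_sets add: sMF)
  \<comment> \<open>The conditional expectation of the indicator of \<open>Z \<in> A\<close> is
    tested on \<open>B \<in> sets F\<close>. Only one \<open>A\<close> is treated at a time, so the
    null set in the defining identity may depend on \<open>A\<close>.\<close>
  have rect: "emeasure D1 (B \<times> A) = emeasure D2 (B \<times> A)" if B: "B \<in> sets F" and A: "A \<in> sets S" for A B
  proof -
    have BM: "B \<in> sets M" using B sF by auto
    let ?i = "indicator (Z -` A \<inter> space M) :: _ \<Rightarrow> real"
    have ZA: "Z -` A \<inter> space M \<in> sets M" using A by measurable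
    have int: "integrable M ?i"
      using ZA by (intro integrable_real_indicator) (auto simp: emeasure_eq_measure)
    have ae: "AE \<omega> in M. measure (\<kappa> \<omega>) A = real_cond_exp M F ?i \<omega>"
      using \<kappa> A by (simp add: regular_cond_distr_def)
    have mk: "(\<lambda>\<omega>. measure (\<kappa> \<omega>) A) \<in> borel_measurable M"
      by (intro measurable_from_subalg[OF sub] measurable_compose[OF k] measurable_measure_prob_algebra A)
    have mk1: "AE \<omega> in M. measure (\<kappa> \<omega>) A \<le> 1"
      using kp by (auto intro!: AE_I2 prob_space.prob_le_1)
    have intk: "integrable M (\<lambda>\<omega>. indicator B \<omega> * measure (\<kappa> \<omega>) A)"
      using mk mk1 BM by (intro integrable_const_bound[of _ 1]) (auto simp: indicator_def)
    have "emeasure D1 (B \<times> A) = emeasure M (B \<inter> (Z -` A \<inter> space M))"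
      unfolding D1_def using A B BM sets.sets_into_space[OF BM]
      by (subst emeasure_distr) (auto intro!: arg_cong[where f="emeasure M"])
    also have "\<dots> = ennreal (LINT \<omega>|M. indicator B \<omega> * ?i \<omega>)"
    proof -
      have "(LINT \<omega>|M. indicator B \<omega> * ?i \<omega>) = (LINT \<omega>|M. indicator (B \<inter> (Z -` A \<inter> space M)) \<omega>)"
        by (simp only: indicator_inter_arith)
      then show ?thesis using BM ZA sets.sets_into_space[OF BM]
        by (simp add: emeasure_eq_measure Int_absorb2 le_infI1)
    qed
    also have "(LINT \<omega>|M. indicator B \<omega> * ?i \<omega>) = (LINT \<omega>|M. indicator B \<omega> * real_cond_exp M F ?i \<omega>)"
      using real_cond_exp_intA[OF int B] by (simp add: set_lebesgue_integral_def)
    also have "\<dots> = (LINT \<omega>|M. indicator B \<omega> * measure (\<kappa> \<omega>) A)"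
      using ae BM mk by (intro integral_cong_AE) auto
    also have "ennreal \<dots> = (\<integral>\<^sup>+\<omega>. ennreal (indicator B \<omega> * measure (\<kappa> \<omega>) A) \<partial>M)"
      using intk by (intro nn_integral_eq_integral[symmetric]) auto
    also have "\<dots> = (\<integral>\<^sup>+\<omega>. emeasure (distr (\<kappa> \<omega>) (F \<Otimes>\<^sub>M S) (Pair \<omega>)) (B \<times> A) \<partial>M)"
    proof (rule nn_integral_cong)
      fix \<omega> assume w: "\<omega> \<in> space M"
      interpret k: prob_space "\<kappa> \<omega>" by (rule kp[OF w])
      note [measurable_cong] = kp(2)[OF w]
      have "Pair \<omega> \<in> \<kappa> \<omega> \<rightarrow>\<^sub>M F \<Otimes>\<^sub>M S" using w by (simp add: spF)
      then have "emeasure (distr (\<kappa> \<omega>) (F \<Otimes>\<^sub>M S) (Pair \<omega>)) (B \<times> A)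
          = emeasure (\<kappa> \<omega>) (Pair \<omega> -` (B \<times> A) \<inter> space (\<kappa> \<omega>))"
        using A B by (intro emeasure_distr) auto
      also have "Pair \<omega> -` (B \<times> A) \<inter> space (\<kappa> \<omega>) = (if \<omega> \<in> B then A else {})"
        using sets.sets_into_space[OF A] sets_eq_imp_space_eq[OF kp(2)[OF w]] by auto
      finally show "ennreal (indicator B \<omega> * measure (\<kappa> \<omega>) A) = 
         emeasure (distr (\<kappa> \<omega>) (F \<Otimes>\<^sub>M S) (Pair \<omega>)) (B \<times> A)"
        by (simp add: k.emeasure_eq_measure)
    qed
    also have "\<dots> = emeasure D2 (B \<times> A)"
      unfolding D2_def using A B kk
      by (subst emeasure_bind[OF ne kk'])
         (auto simp: MF_def intro!: nn_integral_distr[symmetric] measurable_emeasure_kernel)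
    finally show ?thesis .
  qed
  have "D1 = D2"
  proof (rule measure_eqI_generator_eq[OF Int_stable_pair_measure_generator[of F S]])
    let ?E = "{a \<times> b |a b. a \<in> sets F \<and> b \<in> sets S}"
    show "?E \<subseteq> Pow (space F \<times> space S)"
      using sets.space_closed[of F] sets.space_closed[of S] by auto
    show "sets D1 = sigma_sets (space F \<times> space S) ?E"
      by (simp add: D1_def sets_pair_measure)
    show "sets D2 = sigma_sets (space F \<times> space S) ?E"
      unfolding D2_def sets_pair_measure[symmetric] by (rule sets_bind[OF _ ne]) simp
    show "range (\<lambda>i::nat. space F \<times> space S) \<subseteq> ?E" by blast
    show "emeasure D1 X = emeasure D2 X" if "X \<in> ?E" for X
      using that rect by blast
    show "emeasure D1 (space F \<times> space S) \<noteq> \<infinity>" for i :: nat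
    proof -
      have "finite_measure D1" unfolding D1_def by (intro finite_measure_distr) simp
      then show ?thesis by (simp add: finite_measure.emeasure_eq_measure)
    qed
  qed auto
  have "(\<integral>\<^sup>+\<omega>. g \<omega> (Z \<omega>) \<partial>M) = (\<integral>\<^sup>+p. case_prod g p \<partial>D1)"
    unfolding D1_def by (subst nn_integral_distr) auto
  also have "\<dots> = (\<integral>\<^sup>+\<omega>. \<integral>\<^sup>+p. case_prod g p \<partial>distr (\<kappa> \<omega>) (F \<Otimes>\<^sub>M S) (Pair \<omega>) \<partial>MF)"
    unfolding \<open>D1 = D2\<close> D2_def by (rule nn_integral_bind[OF g kk'])
  also have "\<dots> = (\<integral>\<^sup>+\<omega>. \<integral>\<^sup>+p. case_prod g p \<partial>distr (\<kappa> \<omega>) (F \<Otimes>\<^sub>M S) (Pair \<omega>) \<partial>M)"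
    unfolding MF_def
    by (rule nn_integral_distr) (auto intro!: nn_integral_measurable_subprob_algebra2[OF _ kk])
  also have "\<dots> = (\<integral>\<^sup>+\<omega>. \<integral>\<^sup>+z. g \<omega> z \<partial>\<kappa> \<omega> \<partial>M)"
  proof (rule nn_integral_cong)
    fix \<omega> assume w: "\<omega> \<in> space M"
    note [measurable_cong] = kp(2)[OF w]
    have P: "Pair \<omega> \<in> \<kappa> \<omega> \<rightarrow>\<^sub>M F \<Otimes>\<^sub>M S" using w by (simp add: spF)
    show "(\<integral>\<^sup>+p. case_prod g p \<partial>distr (\<kappa> \<omega>) (F \<Otimes>\<^sub>M S) (Pair \<omega>)) = (\<integral>\<^sup>+z. g \<omega> z \<partial>\<kappa> \<omega>)"
      using g by (subst nn_integral_distr[OF P]) (simp_all only: measurable_distr_eq1 prod.case)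
  qed
  finally show ?thesis .
qed

section \<open>Almost sure equality of kernels\<close>

text \<open>The null set in \<open>eq\<close> depends on \<open>A\<close>. Second countability
  provides a countable pi-system generating the Borel sets. The countably many null sets belonging
  to it have a null union, and outside that union uniqueness of finite measures on a pi-system gives
  equality on all sets at once.\<close>

lemma AE_kernel_eqI:
  fixes S :: "'a::second_countable_topology set"
  assumes S: "S \<in> sets borel"
    and sets: "\<And>\<omega>. \<omega> \<in> space M \<Longrightarrow> sets (\<kappa> \<omega>) = sets (borel_on S)" "\<And>\<omega>. \<omega> \<in> space M \<Longrightarrow> sets (\<eta> \<omega>) = sets (borel_on S)"
    and fin: "AE \<omega> in M. emeasure (\<kappa> \<omega>) S \<noteq> \<infinity>"
    and eq: "\<And>A. A \<in> sets (borel_on S) \<Longrightarrow> AE \<omega> in M. emeasure (\<kappa> \<omega>) A = emeasure (\<eta> \<omega>) A"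
  shows "AE \<omega> in M. \<kappa> \<omega> = \<eta> \<omega>"
proof -
  obtain B :: "'a set set" where B: "countable B" "topological_basis B"
    using ex_countable_basis by auto
  \<comment> \<open>Finite intersections of basis sets are again countably many and form a
    pi-system. The empty intersection contributes \<open>UNIV\<close>, the exhausting set of finite
    mass in the uniqueness theorem.\<close>
  define C where "C = Inter ` {F. finite F \<and> F \<subseteq> B}"
  have C: "countable C"
    unfolding C_def by (intro countable_image countable_Collect_finite_subset B)
  have Copen: "open A" if "A \<in> C" for A
    using that B(2) by (auto simp: C_def topological_basis_open intro!: open_Inter)
  have BC: "B \<subseteq> C" by (auto simp: C_def intro!: image_eqI[of _ _ "{_}"])
  have UC: "UNIV \<in> C" by (auto simp: C_def intro!: image_eqI[of _ _ "{}"])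
  have stable: "Int_stable C"
  proof (rule Int_stableI)
    fix a b assume "a \<in> C" "b \<in> C"
    then obtain F G where "finite F" "F \<subseteq> B" "a = \<Inter>F" "finite G" "G \<subseteq> B" "b = \<Inter>G"
      by (auto simp: C_def)
    then show "a \<inter> b \<in> C" by (auto simp: C_def intro!: image_eqI[of _ _ "F \<union> G"])
  qed
  have borel: "sets borel = sigma_sets UNIV C"
  proof
    have "sets borel = sigma_sets UNIV B"
      by (simp add: borel_eq_countable_basis[OF B])
    also have "\<dots> \<subseteq> sigma_sets UNIV C" using BC by (rule sigma_sets_mono')
    finally show "sets borel \<subseteq> sigma_sets UNIV C" .
    show "sigma_sets UNIV C \<subseteq> sets borel"
      using Copen sets.sigma_sets_subset[of C borel] by (metis borel_open space_borel subsetI)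
  qed
  have SA: "S \<inter> A \<in> sets (borel_on S)" if "A \<in> sets borel" for A
    using that by (auto simp: sets_restrict_space)
  have "AE \<omega> in M. \<forall>A\<in>C. emeasure (\<kappa> \<omega>) (S \<inter> A) = emeasure (\<eta> \<omega>) (S \<inter> A)"
    using C Copen by (auto simp: AE_ball_countable intro!: eq SA)
  with fin AE_space show ?thesis
  proof eventually_elim
    case (elim \<omega>)
    note [measurable_cong] = sets[OF elim(2)]
    have sp: "space (\<kappa> \<omega>) = S" "space (\<eta> \<omega>) = S"
      using sets[OF elim(2), THEN sets_eq_imp_space_eq] by (simp_all add: space_restrict_space)
    have id[measurable]: "(\<lambda>x. x) \<in> borel_on S \<rightarrow>\<^sub>M borel" by (rule measurable_restrict_space1) simp
    have em: "emeasure (distr (\<kappa> \<omega>) borel (\<lambda>x. x)) A = emeasure (\<kappa> \<omega>) (S \<inter> A)"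
      "emeasure (distr (\<eta> \<omega>) borel (\<lambda>x. x)) A = emeasure (\<eta> \<omega>) (S \<inter> A)" if "A \<in> sets borel" for A
      using that by (simp_all add: emeasure_distr sp Int_commute)
    \<comment> \<open>\<open>C\<close> generates the Borel sets of the whole space and not their
      trace on \<open>S\<close>, so the images under the inclusion are compared. As \<open>S\<close>
      is Borel, every measurable subset of \<open>S\<close> is Borel and the equality can be read
      back on \<open>S\<close>.\<close>
    have *: "distr (\<kappa> \<omega>) borel (\<lambda>x. x) = distr (\<eta> \<omega>) borel (\<lambda>x. x)"
    proof (rule measure_eqI_generator_eq[OF stable])
      show "emeasure (distr (\<kappa> \<omega>) borel (\<lambda>x. x)) A = emeasure (distr (\<eta> \<omega>) borel (\<lambda>x. x)) A" if "A \<in> C" for A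
        using elim(3) Copen[OF that] that by (simp add: em)
      show "range (\<lambda>_::nat. UNIV) \<subseteq> C" using UC by auto
      show "emeasure (distr (\<kappa> \<omega>) borel (\<lambda>x. x)) UNIV \<noteq> \<infinity>"
        using elim(1) by (simp add: em)
    qed (auto simp: borel)
    show ?case
    proof (rule measure_eqI)
      fix A assume "A \<in> sets (\<kappa> \<omega>)"
      then have A: "A \<in> sets borel" "S \<inter> A = A"
        using S by (auto simp: sets[OF elim(2)] sets_restrict_space)
      show "emeasure (\<kappa> \<omega>) A = emeasure (\<eta> \<omega>) A"
        using em[OF A(1)] * A(2) by simp
    qed (simp add: sets[OF elim(2)])
  qed
qed

section \<open>Approximation along a filtration\<close>

text \<open>The sets that can be approximated in measure from the \<open>F n\<close> form a
  sigma-algebra. Complements have the same symmetric difference. A countable union is first cut to a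
  finite one by continuity of the measure, and finitely many approximants live at a common index
  because the filtration increases.\<close>

lemma sigma_sets_filtration_approx:
  fixes F :: "nat \<Rightarrow> 'a measure"
  assumes "prob_space N" and F: "\<And>n. subalgebra N (F n)"
    and mono: "\<And>m n. m \<le> n \<Longrightarrow> sets (F m) \<subseteq> sets (F n)"
    and A: "A \<in> sigma_sets (space N) (\<Union>n. sets (F n))" and "\<epsilon> > 0"
  shows "\<exists>n. \<exists>B\<in>sets (F n). measure N ((A - B) \<union> (B - A)) < \<epsilon>"
  using A \<open>\<epsilon> > 0\<close>
proof (induction arbitrary: \<epsilon> rule: sigma_sets.induct)
  interpret prob_space N by fact
  have FN: "B \<in> sets N" "B \<subseteq> space N" if "B \<in> sets (F n)" for B n
    using that F[of n] sets.sets_into_space[OF that] by (auto simp: subalgebra_def)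
  have Fsp: "space (F n) = space N" for n using F[of n] by (simp add: subalgebra_def)
  have UN: "(\<Union>n. sets (F n)) \<subseteq> sets N" using FN by auto
  {
    case (Basic a)
    then show ?case by (auto intro!: bexI[of _ a])
  next
    case Empty
    then show ?case by (auto intro!: bexI[of _ "{}"])
  next
    case (Compl a)
    obtain n B where B: "B \<in> sets (F n)" "measure N ((a - B) \<union> (B - a)) < \<epsilon>"
      using Compl by blast
    have a: "a \<subseteq> space N"
      using Compl(1) UN sets.sets_into_space sets.sigma_sets_subset[OF UN] by blast
    have "(space N - a - (space N - B)) \<union> (space N - B - (space N - a)) = (a - B) \<union> (B - a)"
      using a FN[OF B(1)] by auto
    with B Fsp show ?case by (auto intro!: exI[of _ n] bexI[of _ "space N - B"] simp: Fsp[of n, symmetric])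
  next
    case (Union a)
    have aN: "a i \<in> sets N" for i
      using Union(1)[of i] sets.sigma_sets_subset[OF UN] by auto
    have "(\<lambda>k. measure N (\<Union>i\<le>k. a i)) \<longlonglongrightarrow> measure N (\<Union>k. \<Union>i\<le>k. a i)"
      by (intro finite_Lim_measure_incseq) (auto simp: incseq_def intro: aN dest: order_trans)
    also have "(\<Union>k. \<Union>i\<le>k. a i) = (\<Union>i. a i)" by auto
    finally have "\<forall>\<^sub>F k in sequentially. dist (measure N (\<Union>i\<le>k. a i)) (measure N (\<Union>i. a i)) < \<epsilon>/2"
      using \<open>0 < \<epsilon>\<close> unfolding tendsto_iff by (meson half_gt_zero)
    then obtain k where k: "dist (measure N (\<Union>i\<le>k. a i)) (measure N (\<Union>i. a i)) < \<epsilon>/2"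
      by (auto simp: eventually_sequentially)
    have k': "measure N ((\<Union>i. a i) - (\<Union>i\<le>k. a i)) < \<epsilon>/2"
      using k aN by (subst finite_measure_Diff) (auto simp: dist_real_def abs_if split: if_splits)
    \<comment> \<open>One half of \<open>\<epsilon>\<close> is spent on the tail of the union, the
      other half on the \<open>Suc k\<close> sets with indices up to \<open>k\<close>.\<close>
    define d where "d = \<epsilon> / (2 * real (Suc k))"
    have d: "d > 0" using \<open>0 < \<epsilon>\<close> by (simp add: d_def)
    have "\<forall>i. \<exists>n B. B \<in> sets (F n) \<and> measure N ((a i - B) \<union> (B - a i)) < d"
      using Union(2)[OF d] by blast
    then obtain n B where B: "\<And>i. B i \<in> sets (F (n i))"
        "\<And>i. measure N ((a i - B i) \<union> (B i - a i)) < d"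
      by metis
    define m where "m = (MAX i\<in>{..k}. n i)"
    have "n i \<le> m" if "i \<le> k" for i using that by (auto simp: m_def intro!: Max_ge)
    then have "B i \<in> sets (F m)" if "i \<le> k" for i using B(1)[of i] mono that by blast
    then have Bm: "(\<Union>i\<le>k. B i) \<in> sets (F m)" by auto
    let ?D = "\<lambda>i. (a i - B i) \<union> (B i - a i)"
    have DN: "?D i \<in> sets N" for i using aN FN(1)[OF B(1)] by auto
    let ?B = "\<Union>i\<le>k. B i"
    have BN: "?B \<in> sets N" using FN(1)[OF B(1)] by auto
    have "measure N (((\<Union>i. a i) - ?B) \<union> (?B - (\<Union>i. a i)))
      \<le> measure N (((\<Union>i. a i) - (\<Union>i\<le>k. a i)) \<union> (\<Union>i\<le>k. ?D i))"
      using aN DN BN by (intro finite_measure_mono) auto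
    also have "\<dots> \<le> measure N ((\<Union>i. a i) - (\<Union>i\<le>k. a i)) + measure N (\<Union>i\<le>k. ?D i)"
      using aN DN by (intro measure_Un_le) auto
    also have "measure N (\<Union>i\<le>k. ?D i) \<le> (\<Sum>i\<le>k. measure N (?D i))"
      using DN by (intro finite_measure_subadditive_finite) auto
    also have "\<dots> \<le> (\<Sum>i\<le>k. d)" using B(2) by (intro sum_mono) (simp add: less_imp_le)
    also have "\<dots> = \<epsilon>/2" by (simp add: d_def field_simps)
    finally have "measure N (((\<Union>i. a i) - ?B) \<union> (?B - (\<Union>i. a i))) < \<epsilon>" using k' by simp
    with Bm show ?case by blast
  }
qed

text \<open>Functions measurable at a finite level are dense in \<open>L^1\<close> of the generated
  sigma-algebra. The induction over integrable functions starts from scaled indicators, whose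
  \<open>L^1\<close> distance is a multiple of the measure of a symmetric difference. Sums use the
  larger of two indices, and limits use dominated convergence.\<close>

lemma integrable_filtration_approx:
  fixes F :: "nat \<Rightarrow> 'a measure" and U :: "'a \<Rightarrow> real"
  assumes "prob_space N" and F: "\<And>n. subalgebra N (F n)"
    and mono: "\<And>m n. m \<le> n \<Longrightarrow> sets (F m) \<subseteq> sets (F n)"
    and N: "sets N = sigma_sets (space N) (\<Union>n. sets (F n))"
    and U: "integrable N U" and "\<epsilon> > 0"
  shows "\<exists>n. \<exists>V\<in>borel_measurable (F n). integrable N V \<and> (LINT x|N. \<bar>U x - V x\<bar>) < \<epsilon>"
  using U \<open>\<epsilon> > 0\<close>
proof (induction arbitrary: \<epsilon> rule: integrable_induct)
  interpret prob_space N by fact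
  {
    case (base A c)
    \<comment> \<open>The added \<open>1\<close> keeps the quotient meaningful for
      \<open>c = 0\<close>.\<close>
    have "\<epsilon> / (\<bar>c\<bar> + 1) > 0" using base by simp
    then obtain n B where B: "B \<in> sets (F n)" "measure N ((A - B) \<union> (B - A)) < \<epsilon> / (\<bar>c\<bar> + 1)"
      using sigma_sets_filtration_approx[of N F A "\<epsilon> / (\<bar>c\<bar> + 1)"] base \<open>prob_space N\<close> F mono unfolding N[symmetric] by blast
    have BN: "B \<in> sets N" using B(1) F[of n] by (auto simp: subalgebra_def)
    have "(LINT x|N. \<bar>indicator A x *\<^sub>R c - indicator B x *\<^sub>R c\<bar>)
       = (LINT x|N. \<bar>c\<bar> * indicator ((A - B) \<union> (B - A)) x)"
      by (intro Bochner_Integration.integral_cong) (auto simp: indicator_def)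
    also have "\<dots> = \<bar>c\<bar> * measure N ((A - B) \<union> (B - A))"
      using BN base by (simp add: Int_absorb1 sets.sets_into_space)
    also have "\<dots> \<le> (\<bar>c\<bar> + 1) * measure N ((A - B) \<union> (B - A))"
      by (intro mult_right_mono) auto
    also have "\<dots> < \<epsilon>" using B(2) by (simp add: field_simps)
    finally show ?case using B(1) BN
      by (intro exI[of _ n] bexI[of _ "\<lambda>x. indicator B x *\<^sub>R c"]) (auto simp: emeasure_eq_measure)
  next
    case (add f g)
    have "\<epsilon>/2 > 0" using add by simp
    then obtain n1 n2 V1 V2 where V: "V1 \<in> borel_measurable (F n1)" "integrable N V1" "(LINT x|N. \<bar>f x - V1 x\<bar>) < \<epsilon>/2"
      "V2 \<in> borel_measurable (F n2)" "integrable N V2" "(LINT x|N. \<bar>g x - V2 x\<bar>) < \<epsilon>/2"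
      using add.IH by meson
    define n where "n = max n1 n2"
    have sub: "subalgebra (F n) (F n1)" "subalgebra (F n) (F n2)"
      unfolding n_def subalgebra_def using F mono[of n1 "max n1 n2"] mono[of n2 "max n1 n2"]
      by (simp_all add: subalgebra_def)
    have "V1 \<in> borel_measurable (F n)" "V2 \<in> borel_measurable (F n)"
      using V sub by (auto intro: measurable_from_subalg)
    then have m: "(\<lambda>x. V1 x + V2 x) \<in> borel_measurable (F n)" by simp
    have "(LINT x|N. \<bar>f x + g x - (V1 x + V2 x)\<bar>) \<le> (LINT x|N. \<bar>f x - V1 x\<bar> + \<bar>g x - V2 x\<bar>)"
      using V add.hyps by (intro integral_mono) auto
    also have "\<dots> < \<epsilon>" using V add.hyps by (subst Bochner_Integration.integral_add) auto
    finally show ?case using V by (intro exI[of _ n] bexI[OF _ m]) auto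
  next
    case (lim f s)
    \<comment> \<open>The induction rule supplies simple functions bounded by
      \<open>2 * norm (f x)\<close>, hence the dominating function
      \<open>3 * \<bar>f x\<bar>\<close> for the difference.\<close>
    have "(\<lambda>i. LINT x|N. \<bar>f x - s i x\<bar>) \<longlonglongrightarrow> (LINT x|N. 0)"
    proof (rule integral_dominated_convergence[where w="\<lambda>x. 3 * \<bar>f x\<bar>"])
      show "AE x in N. (\<lambda>i. \<bar>f x - s i x\<bar>) \<longlonglongrightarrow> 0"
      proof (rule AE_I2)
        fix x assume "x \<in> space N"
        then have "(\<lambda>i. \<bar>f x - s i x\<bar>) \<longlonglongrightarrow> \<bar>f x - f x\<bar>"
          using lim by (intro tendsto_intros) auto
        then show "(\<lambda>i. \<bar>f x - s i x\<bar>) \<longlonglongrightarrow> 0" by simp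
      qed
      show "AE x in N. norm \<bar>f x - s i x\<bar> \<le> 3 * \<bar>f x\<bar>" for i
        
      proof (rule AE_I2)
        fix x assume "x \<in> space N"
        then have "norm (s i x) \<le> 2 * norm (f x)" using lim.hyps by blast
        then show "norm \<bar>f x - s i x\<bar> \<le> 3 * \<bar>f x\<bar>" by simp
      qed
    qed (use lim in auto)
    then have "\<forall>\<^sub>F i in sequentially. (LINT x|N. \<bar>f x - s i x\<bar>) < \<epsilon>/2"
      using lim.prems by (intro order_tendstoD) auto
    then obtain i where i: "(LINT x|N. \<bar>f x - s i x\<bar>) < \<epsilon>/2"
      by (auto simp: eventually_sequentially)
    obtain n V where V: "V \<in> borel_measurable (F n)" "integrable N V" "(LINT x|N. \<bar>s i x - V x\<bar>) < \<epsilon>/2"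
      using lim.IH lim.prems by (metis half_gt_zero)
    have "(LINT x|N. \<bar>f x - V x\<bar>) \<le> (LINT x|N. \<bar>f x - s i x\<bar> + \<bar>s i x - V x\<bar>)"
      using V lim.hyps by (intro integral_mono) auto
    also have "\<dots> < \<epsilon>" using V i lim.hyps by (subst Bochner_Integration.integral_add) auto
    finally show ?case using V by (intro exI[of _ n] bexI[OF _ V(1)]) auto
  }
qed

section \<open>The sigma-algebras generated by outputs and histories\<close>

text \<open>This turns measurability into an inclusion of generators. \<open>output_algebra\<close>
  and \<open>history_algebra\<close> are generated by such preimage algebras, so their minimality
  becomes a statement about measurable maps.\<close>

lemma sets_vimage_algebra_subset_iff:
  assumes "f \<in> \<Omega> \<rightarrow> space N" "space M = \<Omega>"
  shows "sets (vimage_algebra \<Omega> f N) \<subseteq> sets M \<longleftrightarrow> f \<in> M \<rightarrow>\<^sub>M N"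
proof
  assume *: "sets (vimage_algebra \<Omega> f N) \<subseteq> sets M"
  show "f \<in> M \<rightarrow>\<^sub>M N"
  proof (rule measurableI)
    show "f -` A \<inter> space M \<in> sets M" if "A \<in> sets N" for A
      using in_vimage_algebra[OF that, of f \<Omega>] * assms(2) by auto
  qed (use assms in auto)
next
  assume "f \<in> M \<rightarrow>\<^sub>M N"
  then show "sets (vimage_algebra \<Omega> f N) \<subseteq> sets M"
    unfolding sets_vimage_algebra2[OF assms(1)] using assms(2) by (auto intro: measurable_sets)
qed

lemma
  assumes "\<And>i. i \<in> I \<Longrightarrow> Y i \<in> \<Omega> \<rightarrow> space SY"
  shows space_output_algebra: "space (output_algebra \<Omega> SY Y I) = \<Omega>"
    and sets_output_algebra:
      "sets (output_algebra \<Omega> SY Y I) = sigma_sets \<Omega> (\<Union>i\<in>I. sets (vimage_algebra \<Omega> (Y i) SY))"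
    and measurable_output_algebra: "i \<in> I \<Longrightarrow> Y i \<in> output_algebra \<Omega> SY Y I \<rightarrow>\<^sub>M SY"
    and sets_output_algebra_subset: "space M = \<Omega> \<Longrightarrow> (\<And>i. i \<in> I \<Longrightarrow> Y i \<in> M \<rightarrow>\<^sub>M SY) \<Longrightarrow>
      sets (output_algebra \<Omega> SY Y I) \<subseteq> sets M"
proof -
  have P: "(\<Union>i\<in>I. sets (vimage_algebra \<Omega> (Y i) SY)) \<subseteq> Pow \<Omega>"
    using sets.space_closed[of "vimage_algebra \<Omega> _ SY"] by auto
  show sp: "space (output_algebra \<Omega> SY Y I) = \<Omega>"
    unfolding output_algebra_def by (rule space_measure_of[OF P])
  show s: "sets (output_algebra \<Omega> SY Y I) = sigma_sets \<Omega> (\<Union>i\<in>I. sets (vimage_algebra \<Omega> (Y i) SY))"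
    unfolding output_algebra_def by (rule sets_measure_of[OF P])
  show "Y i \<in> output_algebra \<Omega> SY Y I \<rightarrow>\<^sub>M SY" if "i \<in> I"
    using assms[OF that] sp that
    by (subst sets_vimage_algebra_subset_iff[symmetric, where \<Omega>=\<Omega>]) (auto simp: s)
  show "sets (output_algebra \<Omega> SY Y I) \<subseteq> sets M" if "space M = \<Omega>" "\<And>i. i \<in> I \<Longrightarrow> Y i \<in> M \<rightarrow>\<^sub>M SY"
  proof -
    have "(\<Union>i\<in>I. sets (vimage_algebra \<Omega> (Y i) SY)) \<subseteq> sets M"
      using that assms by (simp add: UN_subset_iff sets_vimage_algebra_subset_iff)
    from sets.sigma_sets_subset[OF this] show ?thesis using that by (simp add: s)
  qed
qed

lemma
  fixes n :: nat
  assumes "W \<in> M \<rightarrow>\<^sub>M SW" "\<And>i. 1 \<le> i \<Longrightarrow> X i \<in> M \<rightarrow>\<^sub>M SX" "\<And>i. 1 \<le> i \<Longrightarrow> Y i \<in> M \<rightarrow>\<^sub>M SY"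
  defines "H \<equiv> history_algebra (space M) SW SX SY W X Y n"
  shows subalgebra_history: "subalgebra M H"
    and measurable_history_message: "W \<in> H \<rightarrow>\<^sub>M SW"
    and measurable_history_output: "i \<in> {1..<n} \<Longrightarrow> Y i \<in> H \<rightarrow>\<^sub>M SY"
proof -
  let ?V = "\<lambda>f N. sets (vimage_algebra (space M) f N)"
  let ?G = "?V W SW \<union> (\<Union>i\<in>{1..n}. ?V (X i) SX) \<union> (\<Union>i\<in>{1..<n}. ?V (Y i) SY)"
  have P: "?G \<subseteq> Pow (space M)"
    by (intro Un_least UN_least) (metis sets.space_closed space_vimage_algebra)+
  have sp: "space H = space M" and s: "sets H = sigma_sets (space M) ?G"
    unfolding H_def history_algebra_def by (rule space_measure_of[OF P] sets_measure_of[OF P])+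
  have Wsp: "W \<in> space M \<rightarrow> space SW" and Xsp: "\<And>i. 1 \<le> i \<Longrightarrow> X i \<in> space M \<rightarrow> space SX"
    and Ysp: "\<And>i. 1 \<le> i \<Longrightarrow> Y i \<in> space M \<rightarrow> space SY"
    using assms(1-3)[THEN measurable_space] by auto
  have "?G \<subseteq> sets M"
    using assms(1-3) Wsp Xsp Ysp by (simp add: UN_subset_iff sets_vimage_algebra_subset_iff)
  from sets.sigma_sets_subset[OF this] sp s show "subalgebra M H" by (simp add: subalgebra_def)
  show "W \<in> H \<rightarrow>\<^sub>M SW"
    by (subst sets_vimage_algebra_subset_iff[symmetric, OF Wsp sp]) (auto simp: s)
  show "Y i \<in> H \<rightarrow>\<^sub>M SY" if "i \<in> {1..<n}"
    using that by (subst sets_vimage_algebra_subset_iff[symmetric, OF Ysp sp]) (auto simp: s)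
qed

section \<open>Change of the message law through the channel\<close>

text \<open>Given the history, \<open>Y n\<close> has law \<open>K (X n \<omega>)\<close>, and
  \<open>X n\<close> is itself a function of the message and the earlier outputs. Disintegration
  over the history algebra therefore integrates the last output out and leaves an expression in
  \<open>W\<close> and the outputs before time \<open>n\<close>.\<close>

lemma nn_integral_channel_step:
  fixes g :: "'w \<times> (nat \<Rightarrow> 'y) \<Rightarrow> ennreal"
  assumes law: "feedback_law SW SX SY K e W X Y \<mu> M" and "1 \<le> n"
    and g: "g \<in> borel_measurable (SW \<Otimes>\<^sub>M (\<Pi>\<^sub>M i\<in>{1..<Suc n}. SY))"
  shows "(\<integral>\<^sup>+\<omega>. g (W \<omega>, \<lambda>i\<in>{1..<Suc n}. Y i \<omega>) \<partial>M)
    = (\<integral>\<^sup>+\<omega>. \<integral>\<^sup>+z. g (W \<omega>, (\<lambda>i\<in>{1..<n}. Y i \<omega>)(n := z)) \<partial>K (e n (W \<omega>, \<lambda>i\<in>{1..<n}. Y i \<omega>)) \<partial>M)"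
proof -
  define H where "H = history_algebra (space M) SW SX SY W X Y n"
  have meas: "W \<in> M \<rightarrow>\<^sub>M SW" "\<And>i. 1 \<le> i \<Longrightarrow> X i \<in> M \<rightarrow>\<^sub>M SX" "\<And>i. 1 \<le> i \<Longrightarrow> Y i \<in> M \<rightarrow>\<^sub>M SY"
    and "prob_space M" and X: "\<And>\<omega>. \<omega> \<in> space M \<Longrightarrow> X n \<omega> = e n (W \<omega>, \<lambda>i\<in>{1..<n}. Y i \<omega>)"
    and rc: "regular_cond_distr M H (Y n) SY (\<lambda>\<omega>. K (X n \<omega>))"
    using law \<open>1 \<le> n\<close> by (auto simp: feedback_law_def H_def)
  have WH[measurable]: "W \<in> H \<rightarrow>\<^sub>M SW" and YH: "\<And>i. i \<in> {1..<n} \<Longrightarrow> Y i \<in> H \<rightarrow>\<^sub>M SY"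
    unfolding H_def using meas by (auto intro!: measurable_history_message measurable_history_output)
  have ins: "insert n {1..<n} = {1..<Suc n}" using \<open>1 \<le> n\<close> by auto
  \<comment> \<open>The update at \<open>n\<close> isolates the freshly drawn output. The remaining
    tuple, over \<open>{1..<n}\<close>, is measurable for the history \<open>H\<close>.\<close>
  have upd: "(\<lambda>i\<in>{1..<Suc n}. Y i \<omega>) = (\<lambda>i\<in>{1..<n}. Y i \<omega>)(n := Y n \<omega>)" for \<omega>
    using \<open>1 \<le> n\<close> by (auto simp: fun_eq_iff restrict_def)
  have YrH: "(\<lambda>\<omega>. \<lambda>i\<in>{1..<n}. Y i \<omega>) \<in> H \<rightarrow>\<^sub>M (\<Pi>\<^sub>M i\<in>{1..<n}. SY)"
    by (rule measurable_restrict) (rule YH)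
  have "(\<lambda>p. ((\<lambda>i\<in>{1..<n}. Y i (fst p))(n := snd p))) \<in> H \<Otimes>\<^sub>M SY \<rightarrow>\<^sub>M (\<Pi>\<^sub>M i\<in>insert n {1..<n}. SY)"
    using measurable_compose[OF measurable_fst YrH] by (intro measurable_fun_upd[where J="{1..<n}"]) auto
  then have "(\<lambda>(\<omega>, z). g (W \<omega>, (\<lambda>i\<in>{1..<n}. Y i \<omega>)(n := z))) \<in> borel_measurable (H \<Otimes>\<^sub>M SY)"
    unfolding split_beta ins by (intro measurable_compose[OF _ g] measurable_Pair) measurable
  from nn_integral_regular_cond_distr[OF \<open>prob_space M\<close> _ meas(3)[OF \<open>1 \<le> n\<close>] rc this]
  have "(\<integral>\<^sup>+\<omega>. g (W \<omega>, (\<lambda>i\<in>{1..<n}. Y i \<omega>)(n := Y n \<omega>)) \<partial>M)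
    = (\<integral>\<^sup>+\<omega>. \<integral>\<^sup>+z. g (W \<omega>, (\<lambda>i\<in>{1..<n}. Y i \<omega>)(n := z)) \<partial>K (X n \<omega>) \<partial>M)"
    unfolding H_def by (simp add: subalgebra_history meas)
  also have "\<dots> = (\<integral>\<^sup>+\<omega>. \<integral>\<^sup>+z. g (W \<omega>, (\<lambda>i\<in>{1..<n}. Y i \<omega>)(n := z)) \<partial>K (e n (W \<omega>, \<lambda>i\<in>{1..<n}. Y i \<omega>)) \<partial>M)"
    by (intro nn_integral_cong) (simp add: X)
  finally show ?thesis unfolding upd .
qed

text \<open>The two laws differ only in the message; every transition uses the same encoder and the
  same kernel. Hence the density \<open>f (W \<omega>)\<close> of the message is the density on
  message and outputs together. The induction integrates the last output out under \<open>P\<close>,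
  changes the law by the hypothesis, and puts the output back under \<open>Q\<close>.\<close>

lemma nn_integral_change_message_law:
  fixes g :: "'w \<times> (nat \<Rightarrow> 'y) \<Rightarrow> ennreal"
  assumes K: "transition_kernel SX SY K" and e: "encoding_scheme SW SX SY e"
    and P: "feedback_law SW SX SY K e W X Y (density \<mu> f) P"
    and Q: "feedback_law SW SX SY K e W X Y \<mu> Q"
    and f: "f \<in> borel_measurable SW" and "1 \<le> n"
    and "g \<in> borel_measurable (SW \<Otimes>\<^sub>M (\<Pi>\<^sub>M i\<in>{1..<n}. SY))"
  shows "(\<integral>\<^sup>+\<omega>. g (W \<omega>, \<lambda>i\<in>{1..<n}. Y i \<omega>) \<partial>P) = (\<integral>\<^sup>+\<omega>. f (W \<omega>) * g (W \<omega>, \<lambda>i\<in>{1..<n}. Y i \<omega>) \<partial>Q)"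
  using assms(6,7)
proof (induction n arbitrary: g rule: dec_induct)
  case (base g)
  have d: "distr P SW W = density \<mu> f" "distr Q SW W = \<mu>" and WP: "W \<in> P \<rightarrow>\<^sub>M SW" and WQ: "W \<in> Q \<rightarrow>\<^sub>M SW"
    using P Q by (auto simp: feedback_law_def)
  have s: "sets \<mu> = sets SW" using d(2) by (metis sets_distr)
  \<comment> \<open>For \<open>n = 1\<close> the index set is empty and the output tuple is this one
    constant function, so the claim concerns the law of \<open>W\<close> alone.\<close>
  let ?u = "\<lambda>i\<in>{1..<1::nat}. undefined :: 'y"
  have u: "(\<lambda>i\<in>{1..<1}. Y i \<omega>) = ?u" for \<omega> by auto
  have "(\<lambda>w. (w, ?u)) \<in> SW \<rightarrow>\<^sub>M SW \<Otimes>\<^sub>M (\<Pi>\<^sub>M i\<in>{1..<1}. SY)"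
    by (intro measurable_Pair measurable_ident_sets measurable_const) (auto simp: space_PiM)
  from measurable_compose[OF this base.prems] have g: "(\<lambda>w. g (w, ?u)) \<in> borel_measurable SW" .
  have "(\<integral>\<^sup>+\<omega>. g (W \<omega>, ?u) \<partial>P) = (\<integral>\<^sup>+w. g (w, ?u) \<partial>density \<mu> f)"
    using nn_integral_distr[OF WP] g unfolding d(1)[symmetric] by (simp add: measurable_distr_eq1)
  also have "\<dots> = (\<integral>\<^sup>+w. f w * g (w, ?u) \<partial>distr Q SW W)"
    using f g s by (subst nn_integral_density) (simp_all cong: measurable_cong_sets add: d)
  also have "\<dots> = (\<integral>\<^sup>+\<omega>. f (W \<omega>) * g (W \<omega>, ?u) \<partial>Q)"
    using f g by (subst nn_integral_distr[OF WQ]) (simp_all add: measurable_distr_eq1)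
  finally show ?case by (simp only: u)
next
  case (step n g)
  let ?M = "\<lambda>n. SW \<Otimes>\<^sub>M (\<Pi>\<^sub>M i\<in>{1..<n::nat}. SY)"
  \<comment> \<open>\<open>p\<close> consists of the message and the outputs before time
    \<open>n\<close>. \<open>G\<close> is \<open>g\<close> averaged over the output at time
    \<open>n\<close>, which makes it an admissible test function for the induction
    hypothesis.\<close>
  define G where "G p = (\<integral>\<^sup>+z. g (fst p, (snd p)(n := z)) \<partial>K (e n p))" for p
  have ins: "insert n {1..<n} = {1..<Suc n}" using step.hyps by auto
  have k: "(\<lambda>p. K (e n p)) \<in> ?M n \<rightarrow>\<^sub>M prob_algebra SY"
    using e K step.hyps by (auto simp: encoding_scheme_def transition_kernel_def intro: measurable_compose)
  have "(\<lambda>q. (snd (fst q))(n := snd q)) \<in> ?M n \<Otimes>\<^sub>M SY \<rightarrow>\<^sub>M (\<Pi>\<^sub>M i\<in>insert n {1..<n}. SY)"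
    by (intro measurable_fun_upd[where J="{1..<n}"]) auto
  then have gm: "(\<lambda>(p, z). g (fst p, (snd p)(n := z))) \<in> borel_measurable (?M n \<Otimes>\<^sub>M SY)"
    unfolding split_beta ins by (intro measurable_compose[OF _ step.prems] measurable_Pair) measurable
  have G: "G \<in> borel_measurable (?M n)"
    unfolding G_def by (rule nn_integral_measurable_subprob_algebra2[OF gm measurable_prob_algebraD[OF k]])
  have YQ: "(\<lambda>\<omega>. (W \<omega>, \<lambda>i\<in>{1..<n}. Y i \<omega>)) \<in> Q \<rightarrow>\<^sub>M ?M n"
    using Q by (intro measurable_Pair measurable_restrict) (auto simp: feedback_law_def)
  have "(\<integral>\<^sup>+\<omega>. g (W \<omega>, \<lambda>i\<in>{1..<Suc n}. Y i \<omega>) \<partial>P) = (\<integral>\<^sup>+\<omega>. G (W \<omega>, \<lambda>i\<in>{1..<n}. Y i \<omega>) \<partial>P)"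
    using nn_integral_channel_step[OF P _ step.prems] step.hyps by (simp add: G_def)
  also have "\<dots> = (\<integral>\<^sup>+\<omega>. f (W \<omega>) * G (W \<omega>, \<lambda>i\<in>{1..<n}. Y i \<omega>) \<partial>Q)"
    by (rule step.IH[OF G])
  also have "\<dots> = (\<integral>\<^sup>+\<omega>. \<integral>\<^sup>+z. f (W \<omega>) * g (W \<omega>, (\<lambda>i\<in>{1..<n}. Y i \<omega>)(n := z))
      \<partial>K (e n (W \<omega>, \<lambda>i\<in>{1..<n}. Y i \<omega>)) \<partial>Q)"
  proof (rule nn_integral_cong)
    fix \<omega> assume "\<omega> \<in> space Q"
    then have p: "(W \<omega>, \<lambda>i\<in>{1..<n}. Y i \<omega>) \<in> space (?M n)" using measurable_space[OF YQ] by auto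
    have "sets (K (e n (W \<omega>, \<lambda>i\<in>{1..<n}. Y i \<omega>))) = sets SY"
      using measurable_space[OF k p] by (simp add: space_prob_algebra)
    moreover have "(\<lambda>z. g (W \<omega>, (\<lambda>i\<in>{1..<n}. Y i \<omega>)(n := z))) \<in> borel_measurable SY"
      using measurable_compose[OF measurable_Pair1'[OF p] gm] by simp
    ultimately show "f (W \<omega>) * G (W \<omega>, \<lambda>i\<in>{1..<n}. Y i \<omega>) =
      (\<integral>\<^sup>+z. f (W \<omega>) * g (W \<omega>, (\<lambda>i\<in>{1..<n}. Y i \<omega>)(n := z)) \<partial>K (e n (W \<omega>, \<lambda>i\<in>{1..<n}. Y i \<omega>)))"
      unfolding G_def by (subst nn_integral_cmult) (simp_all cong: measurable_cong_sets)
  qed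
  also have "\<dots> = (\<integral>\<^sup>+\<omega>. f (W \<omega>) * g (W \<omega>, \<lambda>i\<in>{1..<Suc n}. Y i \<omega>) \<partial>Q)"
  \<comment> \<open>The channel step is read backwards under \<open>Q\<close>, for the integrand
    \<open>f (fst p) * g p\<close>: its factor \<open>f\<close> depends on the message only and is
    unaffected by the update at \<open>n\<close>.\<close>
  proof -
    have "(\<lambda>p. f (fst p) * g p) \<in> borel_measurable (?M (Suc n))"
      by (intro borel_measurable_times_ennreal step.prems measurable_compose[OF measurable_fst f])
    from nn_integral_channel_step[OF Q _ this] step.hyps show ?thesis by simp
  qed
  finally show ?case .
qed

section \<open>Total variation and Bayes' rule\<close>

lemma tv_dist_nonneg:
  assumes "prob_space p" "prob_space q"
  shows "0 \<le> tv_dist p q"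
  unfolding tv_dist_def
\<comment> \<open>The empty set contributes the value 0. A real supremum dominates its members only
  for a family bounded above, so the bound 1 is supplied as well.\<close>
proof (rule cSUP_upper2[where x="{}"])
  interpret p: prob_space p by fact
  interpret q: prob_space q by fact
  show "bdd_above ((\<lambda>A. \<bar>measure p A - measure q A\<bar>) ` sets p)"
  proof (intro bdd_aboveI[of _ 1], clarify)
    fix A show "\<bar>measure p A - measure q A\<bar> \<le> 1"
      using p.prob_le_1[of A] q.prob_le_1[of A] measure_nonneg[of p A] measure_nonneg[of q A] by linarith
  qed
qed auto

text \<open>By \<open>eq\<close> the measure \<open>z * p\<close> has density \<open>f\<close> with
  respect to \<open>q\<close>, so \<open>z * (p A - q A)\<close> is the integral of
  \<open>f - z\<close> over \<open>A\<close>. Keeping the factor \<open>z\<close> on the left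
  includes the case \<open>z = 0\<close>, where the left side vanishes.\<close>

lemma scaled_tv_dist_le:
  assumes "prob_space p" "prob_space q" and sets: "sets p = sets q"
    and f[measurable]: "f \<in> borel_measurable q" and f0: "\<And>x. 0 \<le> f x" and "0 \<le> z"
    and eq: "\<And>A. A \<in> sets q \<Longrightarrow> ennreal z * emeasure p A = (\<integral>\<^sup>+x. ennreal (f x) * indicator A x \<partial>q)"
  shows "ennreal (z * tv_dist p q) \<le> (\<integral>\<^sup>+x. ennreal \<bar>f x - z\<bar> \<partial>q)"
proof -
  interpret p: prob_space p by fact
  interpret q: prob_space q by fact
  \<comment> \<open>Taking the whole space for \<open>A\<close> shows that \<open>f\<close> has the
    finite integral \<open>z\<close>.\<close>
  have "(\<integral>\<^sup>+x. ennreal (f x) \<partial>q) = (\<integral>\<^sup>+x. ennreal (f x) * indicator (space q) x \<partial>q)"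
    by (intro nn_integral_cong) auto
  also have "\<dots> = ennreal z"
    using eq[of "space q"] p.emeasure_space_1 sets_eq_imp_space_eq[OF sets] by simp
  finally have int: "integrable q f"
    using f0 by (intro integrableI_nonneg) auto
  have bnd: "z * \<bar>measure p A - measure q A\<bar> \<le> (LINT x|q. \<bar>f x - z\<bar>)" if A: "A \<in> sets q" for A
  proof -
    have intA: "integrable q (\<lambda>x. f x * indicator A x)"
      using A int by (rule integrable_real_mult_indicator)
    have "ennreal (z * measure p A) = ennreal (LINT x|q. f x * indicator A x)"
      using eq[OF A] \<open>0 \<le> z\<close> f0 intA
      by (subst nn_integral_eq_integral[symmetric])
         (auto simp: ennreal_mult p.emeasure_eq_measure ennreal_indicator[symmetric] simp del: ennreal_indicator)
    then have "z * measure p A = (LINT x|q. f x * indicator A x)"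
      using \<open>0 \<le> z\<close> f0 by (subst (asm) ennreal_inj) (auto intro!: integral_nonneg_AE)
    then have "z * (measure p A - measure q A) = (LINT x|q. f x * indicator A x - z * indicator A x)"
      using A intA by (subst Bochner_Integration.integral_diff)
        (auto simp: right_diff_distrib Int_absorb1 sets.sets_into_space q.emeasure_eq_measure)
    also have "\<bar>\<dots>\<bar> \<le> (LINT x|q. \<bar>f x * indicator A x - z * indicator A x\<bar>)"
      by (rule integral_abs_bound)
    also have "\<dots> \<le> (LINT x|q. \<bar>f x - z\<bar>)"
    proof (rule integral_mono)
      have "integrable q (\<lambda>x. z * indicator A x)"
        using A by (intro integrable_mult_right integrable_real_indicator) (auto simp: q.emeasure_eq_measure)
      with intA show "integrable q (\<lambda>x. \<bar>f x * indicator A x - z * indicator A x\<bar>)"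
        by (intro integrable_abs Bochner_Integration.integrable_diff)
    qed (use int in \<open>auto simp: indicator_def\<close>)
    finally show ?thesis using \<open>0 \<le> z\<close> by (simp add: abs_mult)
  qed
  have "z * tv_dist p q \<le> (LINT x|q. \<bar>f x - z\<bar>)"
  proof (cases "z = 0")
    case False
    then have "z > 0" using \<open>0 \<le> z\<close> by simp
    have "tv_dist p q \<le> (LINT x|q. \<bar>f x - z\<bar>) / z"
      unfolding tv_dist_def using \<open>z > 0\<close> bnd
      by (intro cSUP_least) (auto simp: sets pos_le_divide_eq mult.commute)
    with \<open>z > 0\<close> show ?thesis by (simp add: pos_le_divide_eq mult.commute)
  qed simp
  also have "ennreal (LINT x|q. \<bar>f x - z\<bar>) = (\<integral>\<^sup>+x. ennreal \<bar>f x - z\<bar> \<partial>q)"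
    using int by (intro nn_integral_eq_integral[symmetric]) auto
  finally show ?thesis by (simp add: ennreal_leI)
qed

text \<open>This is the estimate at a fixed time, with \<open>F\<close> in the role of the observed
  outputs. The factor 2 is the price of replacing the conditional mean of
  \<open>f (W \<omega>)\<close> by an arbitrary \<open>F\<close>-measurable \<open>U\<close>: the
  mean is no farther from \<open>U\<close> than \<open>f\<close> is on average.\<close>

lemma expectation_tv_dist_posterior_le:
  fixes S :: "'a::second_countable_topology set" and f :: "'a \<Rightarrow> real"
  assumes "prob_space P" "prob_space Q" and sets: "sets P = sets Q" and sub: "subalgebra Q F"
    and S: "S \<in> sets borel" and W: "W \<in> Q \<rightarrow>\<^sub>M borel_on S"
    and f: "f \<in> borel_measurable (borel_on S)" and f0: "\<And>x. 0 \<le> f x"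
    and \<psi>: "regular_cond_distr P F W (borel_on S) \<psi>"
    and \<phi>: "regular_cond_distr Q F W (borel_on S) \<phi>"
    and eq: "\<And>A B. A \<in> sets (borel_on S) \<Longrightarrow> B \<in> sets F \<Longrightarrow>
       emeasure P (W -` A \<inter> B) = (\<integral>\<^sup>+\<omega>. ennreal (f (W \<omega>)) * indicator A (W \<omega>) * indicator B \<omega> \<partial>Q)"
    and U[measurable]: "U \<in> borel_measurable F"
  shows "ennreal (LINT \<omega>|P. tv_dist (\<psi> \<omega>) (\<phi> \<omega>)) \<le> 2 * (\<integral>\<^sup>+\<omega>. ennreal \<bar>f (W \<omega>) - U \<omega>\<bar> \<partial>Q)"
proof -
  interpret P: prob_space P by fact
  interpret Q: prob_space Q by fact
  define T where "T = borel_on S"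
  have spT: "space T = S" by (simp add: T_def space_restrict_space)
  note T_def[symmetric, simp]
  have sp: "space P = space Q" "space F = space Q"
    using sets_eq_imp_space_eq[OF sets] sub by (auto simp: subalgebra_def)
  have subP: "subalgebra P F" using sub sets sp by (simp add: subalgebra_def)
  have WP[measurable]: "W \<in> P \<rightarrow>\<^sub>M T" and WQ[measurable]: "W \<in> Q \<rightarrow>\<^sub>M T"
    using W by (simp_all cong: measurable_cong_sets add: sets)
  have fT[measurable]: "f \<in> borel_measurable T" using f by simp
  have idP[simp]: "(\<lambda>x. x) \<in> P \<rightarrow>\<^sub>M F" and idQ[simp]: "(\<lambda>x. x) \<in> Q \<rightarrow>\<^sub>M F"
    by (rule measurable_from_subalg[OF subP measurable_ident_sets[OF refl]] measurable_from_subalg[OF sub measurable_ident_sets[OF refl]])+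
  have k: "\<psi> \<in> F \<rightarrow>\<^sub>M prob_algebra T" "\<phi> \<in> F \<rightarrow>\<^sub>M prob_algebra T"
    using \<psi> \<phi> by (auto simp: regular_cond_distr_def transition_kernel_def)
  note ks[measurable] = k[THEN measurable_prob_algebraD]
  have kp: "prob_space (\<psi> \<omega>)" "sets (\<psi> \<omega>) = sets T" "prob_space (\<phi> \<omega>)" "sets (\<phi> \<omega>) = sets T"
    if "\<omega> \<in> space Q" for \<omega>
    using k[THEN measurable_space, of \<omega>] that by (auto simp: sp space_prob_algebra)
  have ksp: "space (\<psi> \<omega>) = S" "space (\<phi> \<omega>) = S" if "\<omega> \<in> space Q" for \<omega>
    using kp(2,4)[OF that, THEN sets_eq_imp_space_eq] spT by auto
  have mk: "g \<in> borel_measurable (\<phi> \<omega>)" if "\<omega> \<in> space Q" "g \<in> borel_measurable T" for \<omega> and g :: "'a \<Rightarrow> 'c::topological_space"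
    using that(2) by (subst measurable_cong_sets[OF kp(4)[OF that(1)] refl])
  \<comment> \<open>Both laws are restricted to \<open>F\<close>, where densities are determined
    almost everywhere and the kernels are measurable.\<close>
  define PF where "PF = distr P F (\<lambda>x. x)"
  define QF where "QF = distr Q F (\<lambda>x. x)"
  have sF[measurable_cong]: "sets PF = sets F" "sets QF = sets F" by (simp_all add: PF_def QF_def)
  have spF: "space PF = space Q" "space QF = space Q" by (simp_all add: PF_def QF_def sp)
  interpret QF: prob_space QF unfolding QF_def by (rule Q.prob_space_distr) simp
  have iP: "(\<integral>\<^sup>+\<omega>. h \<omega> \<partial>PF) = (\<integral>\<^sup>+\<omega>. h \<omega> \<partial>P)" if [measurable]: "h \<in> borel_measurable F" for h
    unfolding PF_def using that by (subst nn_integral_distr) simp_all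
  have iQ: "(\<integral>\<^sup>+\<omega>. h \<omega> \<partial>QF) = (\<integral>\<^sup>+\<omega>. h \<omega> \<partial>Q)" if [measurable]: "h \<in> borel_measurable F" for h
    unfolding QF_def using that by (subst nn_integral_distr) simp_all
  have mF[measurable]: "(\<lambda>\<omega>. \<integral>\<^sup>+w. ennreal (f w) * indicator A w \<partial>\<phi> \<omega>) \<in> borel_measurable F" if [measurable]: "A \<in> sets T" for A
    by (rule nn_integral_measurable_subprob_algebra2[OF _ ks(2)]) measurable
  have mP[measurable]: "(\<lambda>\<omega>. emeasure (\<psi> \<omega>) A) \<in> borel_measurable F" if "A \<in> sets T" for A
    using that by (rule measurable_emeasure_kernel[OF ks(1)])
  \<comment> \<open>\<open>Z\<close> is a version of the conditional expectation of
    \<open>f (W \<omega>)\<close> given \<open>F\<close> under \<open>Q\<close>, with values in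
    \<open>ennreal\<close> until it is known to be finite a.e.\<close>
  define Z where "Z \<omega> = (\<integral>\<^sup>+w. ennreal (f w) \<partial>\<phi> \<omega>)" for \<omega>
  have Z[measurable]: "Z \<in> borel_measurable F"
    unfolding Z_def by (rule nn_integral_measurable_subprob_algebra2[OF _ ks(2)]) measurable
  have ZQF[simp]: "Z \<in> borel_measurable QF" by measurable
  \<comment> \<open>\<open>intP\<close> and \<open>intQ\<close> compute the same probability, that
    of \<open>W \<in> A\<close> together with \<open>B\<close>, once through \<open>\<psi>\<close>
    under \<open>P\<close> and once through \<open>\<phi>\<close> and the density under
    \<open>Q\<close>. Comparing them yields Bayes' rule.\<close>
  have intP: "(\<integral>\<^sup>+\<omega>. emeasure (\<psi> \<omega>) A * indicator B \<omega> \<partial>P) = emeasure P (W -` A \<inter> B)"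
    if A[measurable]: "A \<in> sets T" and B[measurable]: "B \<in> sets F" for A B
  proof -
    have BP: "B \<in> sets P" using B subP by (auto simp: subalgebra_def)
    have "emeasure P (W -` A \<inter> B) = (\<integral>\<^sup>+\<omega>. indicator (W -` A \<inter> space P \<inter> B) \<omega> \<partial>P)"
      using BP sets.sets_into_space[OF BP]
      by (subst nn_integral_indicator) (auto intro!: arg_cong[where f="emeasure P"])
    also have "\<dots> = (\<integral>\<^sup>+\<omega>. indicator A (W \<omega>) * indicator B \<omega> \<partial>P)"
      by (intro nn_integral_cong) (auto simp: indicator_def)
    also have "\<dots> = (\<integral>\<^sup>+\<omega>. \<integral>\<^sup>+w. indicator A w * indicator B \<omega> \<partial>\<psi> \<omega> \<partial>P)"
    proof (rule nn_integral_regular_cond_distr[OF \<open>prob_space P\<close> subP WP])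
      show "(\<lambda>(\<omega>, w). indicator A w * indicator B \<omega> :: ennreal) \<in> borel_measurable (F \<Otimes>\<^sub>M T)"
        by measurable
    qed (use \<psi> in simp)
    also have "\<dots> = (\<integral>\<^sup>+\<omega>. emeasure (\<psi> \<omega>) A * indicator B \<omega> \<partial>P)"
      using A kp by (intro nn_integral_cong) (simp add: sp nn_integral_multc)
    finally show ?thesis by simp
  qed
  have intQ: "(\<integral>\<^sup>+\<omega>. (\<integral>\<^sup>+w. ennreal (f w) * indicator A w \<partial>\<phi> \<omega>) * indicator B \<omega> \<partial>Q) = emeasure P (W -` A \<inter> B)"
    if A[measurable]: "A \<in> sets T" and B[measurable]: "B \<in> sets F" for A B
  proof -
    have "emeasure P (W -` A \<inter> B) = (\<integral>\<^sup>+\<omega>. \<integral>\<^sup>+w. ennreal (f w) * indicator A w * indicator B \<omega> \<partial>\<phi> \<omega> \<partial>Q)"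
      using \<phi> by (subst nn_integral_regular_cond_distr[OF \<open>prob_space Q\<close> sub WQ, symmetric])
         (auto intro!: eq A B)
    also have "\<dots> = (\<integral>\<^sup>+\<omega>. (\<integral>\<^sup>+w. ennreal (f w) * indicator A w \<partial>\<phi> \<omega>) * indicator B \<omega> \<partial>Q)"
      by (intro nn_integral_cong nn_integral_multc) (simp cong: measurable_cong_sets add: kp)
    finally show ?thesis by simp
  qed
  have ZS: "Z \<omega> = (\<integral>\<^sup>+w. ennreal (f w) * indicator S w \<partial>\<phi> \<omega>)" if "\<omega> \<in> space Q" for \<omega>
    unfolding Z_def using ksp[OF that] by (intro nn_integral_cong) auto
  \<comment> \<open>This is \<open>intQ\<close> with \<open>A = S\<close>: the condition on
    \<open>W\<close> is then void and only \<open>B\<close> remains.\<close>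
  have PFd: "PF = density QF Z"
  proof (rule measure_eqI)
    fix B assume "B \<in> sets PF"
    then have B[measurable]: "B \<in> sets F" by (simp add: sF)
    have BP: "B \<in> sets P" using B subP by (auto simp: subalgebra_def)
    have "emeasure PF B = emeasure P (W -` S \<inter> B)"
      unfolding PF_def using B BP sets.sets_into_space[OF BP] measurable_space[OF WP]
      by (subst emeasure_distr) (auto simp: spT intro!: arg_cong[where f="emeasure P"])
    also have "\<dots> = (\<integral>\<^sup>+\<omega>. Z \<omega> * indicator B \<omega> \<partial>Q)"
      using spT B by (subst intQ[symmetric]) (auto simp: ZS intro!: nn_integral_cong)
    also have "\<dots> = emeasure (density QF Z) B"
      by (subst emeasure_density) (auto simp: iQ sF)
    finally show "emeasure PF B = emeasure (density QF Z) B" .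
  qed (simp add: sF)
  \<comment> \<open>The integral of \<open>Z\<close> is the total mass 1 of
    \<open>PF\<close>.\<close>
  have Zfin: "AE \<omega> in QF. Z \<omega> \<noteq> \<infinity>"
  proof (rule nn_integral_PInf_AE)
    have "(\<integral>\<^sup>+\<omega>. Z \<omega> \<partial>QF) = emeasure (density QF Z) (space QF)"
      by (subst emeasure_density) (auto intro!: nn_integral_cong)
    also have "\<dots> = emeasure PF (space PF)" by (simp add: PFd)
    also have "\<dots> = 1" unfolding PF_def by (intro prob_space.emeasure_space_1 P.prob_space_distr) simp
    finally show "(\<integral>\<^sup>+\<omega>. Z \<omega> \<partial>QF) \<noteq> \<infinity>" by simp
  qed measurable
  \<comment> \<open>For each \<open>A\<close> both sides are densities with respect to
    \<open>QF\<close> of the same measure on \<open>F\<close>: the factor \<open>Z\<close> turns an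
    integral over \<open>QF\<close> into one over \<open>PF\<close>, where \<open>intP\<close>
    applies. \<open>AE_kernel_eqI\<close> then removes the dependence of the null set on
    \<open>A\<close>; the supremum over all \<open>A\<close> in the total variation requires
    this.\<close>
  have bayes: "AE \<omega> in QF. density (\<psi> \<omega>) (\<lambda>_. Z \<omega>) = density (\<phi> \<omega>) (\<lambda>w. ennreal (f w))"
  proof (rule AE_kernel_eqI[OF S])
    show "sets (density (\<psi> \<omega>) (\<lambda>_. Z \<omega>)) = sets (borel_on S)"
         "sets (density (\<phi> \<omega>) (\<lambda>w. ennreal (f w))) = sets (borel_on S)" if "\<omega> \<in> space QF" for \<omega>
      using that by (simp_all add: spF kp)
    show "AE \<omega> in QF. emeasure (density (\<psi> \<omega>) (\<lambda>_. Z \<omega>)) S \<noteq> \<infinity>"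
      using Zfin AE_space
    proof eventually_elim
      case (elim \<omega>)
      then have w: "\<omega> \<in> space Q" by (simp add: spF)
      have "S \<in> sets (\<psi> \<omega>)" "emeasure (\<psi> \<omega>) S = 1"
        using prob_space.emeasure_space_1[OF kp(1)[OF w]] ksp[OF w] sets.top[of "\<psi> \<omega>"] by auto
      then show ?case using elim by (simp add: emeasure_density_const)
    qed
    fix A assume "A \<in> sets (borel_on S)"
    then have A[measurable]: "A \<in> sets T" by simp
    have "AE \<omega> in QF. Z \<omega> * emeasure (\<psi> \<omega>) A = (\<integral>\<^sup>+w. ennreal (f w) * indicator A w \<partial>\<phi> \<omega>)"
    proof (rule QF.density_unique)
      show "density QF (\<lambda>\<omega>. Z \<omega> * emeasure (\<psi> \<omega>) A) = density QF (\<lambda>\<omega>. \<integral>\<^sup>+w. ennreal (f w) * indicator A w \<partial>\<phi> \<omega>)"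
      proof (rule measure_eqI)
        fix B assume "B \<in> sets (density QF (\<lambda>\<omega>. Z \<omega> * emeasure (\<psi> \<omega>) A))"
        then have B[measurable]: "B \<in> sets F" by (simp add: sF)
        have "emeasure (density QF (\<lambda>\<omega>. Z \<omega> * emeasure (\<psi> \<omega>) A)) B
            = (\<integral>\<^sup>+\<omega>. Z \<omega> * (emeasure (\<psi> \<omega>) A * indicator B \<omega>) \<partial>QF)"
          by (subst emeasure_density) (auto simp: sF mult.assoc)
        also have "\<dots> = (\<integral>\<^sup>+\<omega>. emeasure (\<psi> \<omega>) A * indicator B \<omega> \<partial>PF)"
          unfolding PFd by (subst nn_integral_density) auto
        also have "\<dots> = (\<integral>\<^sup>+\<omega>. (\<integral>\<^sup>+w. ennreal (f w) * indicator A w \<partial>\<phi> \<omega>) * indicator B \<omega> \<partial>QF)"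
          using A B by (subst iP, measurable, subst iQ, measurable) (simp add: intP intQ)
        also have "\<dots> = emeasure (density QF (\<lambda>\<omega>. \<integral>\<^sup>+w. ennreal (f w) * indicator A w \<partial>\<phi> \<omega>)) B"
          by (subst emeasure_density) (auto simp: sF)
        finally show "emeasure (density QF (\<lambda>\<omega>. Z \<omega> * emeasure (\<psi> \<omega>) A)) B =
          emeasure (density QF (\<lambda>\<omega>. \<integral>\<^sup>+w. ennreal (f w) * indicator A w \<partial>\<phi> \<omega>)) B" .
      qed simp
    qed auto
    with AE_space show "AE \<omega> in QF. emeasure (density (\<psi> \<omega>) (\<lambda>_. Z \<omega>)) A = emeasure (density (\<phi> \<omega>) (\<lambda>w. ennreal (f w))) A"
    proof eventually_elim
      case (elim \<omega>)
      then have w: "\<omega> \<in> space Q" by (simp add: spF)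
      note [measurable_cong] = kp(2,4)[OF w]
      have "A \<in> sets (\<psi> \<omega>)" "A \<in> sets (\<phi> \<omega>)" using A kp[OF w] by simp_all
      moreover have "(\<lambda>w. ennreal (f w)) \<in> borel_measurable (\<phi> \<omega>)" by (rule mk[OF w]) measurable
      ultimately show ?case using elim(2) by (simp only: emeasure_density_const emeasure_density)
    qed
  qed
  define h where "h \<omega> = (\<integral>\<^sup>+w. ennreal \<bar>f w - enn2real (Z \<omega>)\<bar> \<partial>\<phi> \<omega>)" for \<omega>
  have h[measurable]: "h \<in> borel_measurable F"
    unfolding h_def by (rule nn_integral_measurable_subprob_algebra2[OF _ ks(2)]) measurable
  have "AE \<omega> in QF. Z \<omega> * ennreal (tv_dist (\<psi> \<omega>) (\<phi> \<omega>)) \<le> h \<omega>"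
    using bayes Zfin AE_space
  proof eventually_elim
    case (elim \<omega>)
    then have w: "\<omega> \<in> space Q" by (simp add: spF)
    note [measurable_cong] = kp(2,4)[OF w]
    have Zr: "ennreal (enn2real (Z \<omega>)) = Z \<omega>" using elim(2) by (simp add: less_top)
    have "ennreal (enn2real (Z \<omega>) * tv_dist (\<psi> \<omega>) (\<phi> \<omega>)) \<le> h \<omega>"
      unfolding h_def
    proof (rule scaled_tv_dist_le)
      fix A assume A: "A \<in> sets (\<phi> \<omega>)"
      then have A': "A \<in> sets (\<psi> \<omega>)" by (simp add: kp w)
      have "Z \<omega> * emeasure (\<psi> \<omega>) A = emeasure (density (\<psi> \<omega>) (\<lambda>_. Z \<omega>)) A"
        using A' by (simp add: emeasure_density_const)
      also have "\<dots> = (\<integral>\<^sup>+x. ennreal (f x) * indicator A x \<partial>\<phi> \<omega>)"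
        unfolding elim(1) using A by (intro emeasure_density mk[OF w]) auto
      finally show "ennreal (enn2real (Z \<omega>)) * emeasure (\<psi> \<omega>) A = (\<integral>\<^sup>+x. ennreal (f x) * indicator A x \<partial>\<phi> \<omega>)"
        by (simp only: Zr)
    qed (use w kp f0 mk[OF w fT] in auto)
    moreover have "Z \<omega> * ennreal (tv_dist (\<psi> \<omega>) (\<phi> \<omega>)) = ennreal (enn2real (Z \<omega>) * tv_dist (\<psi> \<omega>) (\<phi> \<omega>))"
      using tv_dist_nonneg[OF kp(1)[OF w] kp(3)[OF w]] by (subst ennreal_mult) (simp_all add: Zr)
    ultimately show ?case by simp
  qed
  with Zfin have "AE \<omega> in QF. 0 < Z \<omega> \<longrightarrow> ennreal (tv_dist (\<psi> \<omega>) (\<phi> \<omega>)) \<le> h \<omega> / Z \<omega>"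
  proof eventually_elim
    case (elim \<omega>)
    show ?case
    proof
      assume "0 < Z \<omega>"
      then have "ennreal (tv_dist (\<psi> \<omega>) (\<phi> \<omega>)) = Z \<omega> * ennreal (tv_dist (\<psi> \<omega>) (\<phi> \<omega>)) / Z \<omega>"
        using elim(1) by (subst mult.commute) (simp add: ennreal_mult_divide_eq)
      also have "\<dots> \<le> h \<omega> / Z \<omega>" using elim(2) by (rule divide_right_mono_ennreal)
      finally show "ennreal (tv_dist (\<psi> \<omega>) (\<phi> \<omega>)) \<le> h \<omega> / Z \<omega>" .
    qed
  qed
  \<comment> \<open>\<open>PF\<close> has density \<open>Z\<close>, so it gives no mass to the set
    where \<open>Z\<close> vanishes, and the guard \<open>0 < Z \<omega>\<close> disappears.\<close>
  then have "AE \<omega> in PF. ennreal (tv_dist (\<psi> \<omega>) (\<phi> \<omega>)) \<le> h \<omega> / Z \<omega>"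
    unfolding PFd by (subst AE_density) auto
  then have aeP: "AE \<omega> in P. ennreal (tv_dist (\<psi> \<omega>) (\<phi> \<omega>)) \<le> h \<omega> / Z \<omega>"
    unfolding PF_def by (rule AE_distrD[rotated]) simp
  \<comment> \<open>Measurability of the distance is not needed: a non-integrable function has Bochner integral \<open>0\<close>.\<close>
  have "ennreal (LINT \<omega>|P. tv_dist (\<psi> \<omega>) (\<phi> \<omega>)) \<le> (\<integral>\<^sup>+\<omega>. ennreal (tv_dist (\<psi> \<omega>) (\<phi> \<omega>)) \<partial>P)"
  proof (cases "integrable P (\<lambda>\<omega>. tv_dist (\<psi> \<omega>) (\<phi> \<omega>))")
    case True
    then show ?thesis
      by (subst nn_integral_eq_integral) (auto intro!: AE_I2 tv_dist_nonneg kp simp: sp)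
  qed (simp add: not_integrable_integral_eq)
  also have "\<dots> \<le> (\<integral>\<^sup>+\<omega>. h \<omega> / Z \<omega> \<partial>P)" using aeP by (rule nn_integral_mono_AE)
  also have "\<dots> = (\<integral>\<^sup>+\<omega>. h \<omega> / Z \<omega> \<partial>PF)" by (rule iP[symmetric]) simp
  also have "\<dots> = (\<integral>\<^sup>+\<omega>. Z \<omega> * (h \<omega> / Z \<omega>) \<partial>QF)"
    unfolding PFd by (subst nn_integral_density) auto
  \<comment> \<open>Multiplying by \<open>Z\<close> cancels the quotient where \<open>Z\<close> is
    positive and finite. Where \<open>Z\<close> is 0 the product is 0, whence an inequality.\<close>
  also have "\<dots> \<le> (\<integral>\<^sup>+\<omega>. h \<omega> \<partial>QF)"
  proof (intro nn_integral_mono_AE, use Zfin in eventually_elim)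
    case (elim \<omega>)
    then show ?case
      by (cases "Z \<omega> = 0") (auto simp: ennreal_times_divide mult.commute[of "Z \<omega>"] ennreal_mult_divide_eq)
  qed
  also have "\<dots> \<le> (\<integral>\<^sup>+\<omega>. 2 * (\<integral>\<^sup>+w. ennreal \<bar>f w - U \<omega>\<bar> \<partial>\<phi> \<omega>) \<partial>QF)"
  proof (intro nn_integral_mono_AE, use Zfin AE_space[of QF] in eventually_elim)
    case (elim \<omega>)
    then have w: "\<omega> \<in> space Q" by (simp add: spF)
    note [measurable_cong] = kp(2,4)[OF w]
    interpret k: prob_space "\<phi> \<omega>" by (rule kp[OF w])
    have int: "integrable (\<phi> \<omega>) f"
      using elim(1) f0 by (intro integrableI_nonneg) (auto simp: Z_def less_top intro!: mk[OF w] mk[OF w fT])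
    have "Z \<omega> = ennreal (LINT w|\<phi> \<omega>. f w)"
      unfolding Z_def using int f0 by (intro nn_integral_eq_integral) auto
    then have z: "enn2real (Z \<omega>) = (LINT w|\<phi> \<omega>. f w)"
      using f0 by (simp add: integral_nonneg_AE)
    have "enn2real (Z \<omega>) - U \<omega> = (LINT w|\<phi> \<omega>. f w - U \<omega>)"
      using int k.prob_space by (simp add: z)
    \<comment> \<open>\<open>Z\<close> is the mean of \<open>f\<close> under
      \<open>\<phi> \<omega>\<close>, so its distance from the constant \<open>U \<omega>\<close> is
      at most the mean distance of \<open>f\<close> from it. The triangle inequality through
      \<open>U \<omega>\<close> then bounds \<open>h \<omega>\<close> by twice that
      quantity.\<close>
    then have d: "ennreal \<bar>U \<omega> - enn2real (Z \<omega>)\<bar> \<le> (\<integral>\<^sup>+w. ennreal \<bar>f w - U \<omega>\<bar> \<partial>\<phi> \<omega>)"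
      using integral_norm_bound_ennreal[of "\<phi> \<omega>" "\<lambda>w. f w - U \<omega>"] int k.prob_space
      by (simp add: abs_minus_commute)
    have "h \<omega> \<le> (\<integral>\<^sup>+w. ennreal \<bar>f w - U \<omega>\<bar> + ennreal \<bar>U \<omega> - enn2real (Z \<omega>)\<bar> \<partial>\<phi> \<omega>)"
      unfolding h_def by (intro nn_integral_mono) (simp add: ennreal_plus[symmetric] ennreal_leI del: ennreal_plus)
    also have "\<dots> = (\<integral>\<^sup>+w. ennreal \<bar>f w - U \<omega>\<bar> \<partial>\<phi> \<omega>) + ennreal \<bar>U \<omega> - enn2real (Z \<omega>)\<bar>"
      by (subst nn_integral_add) (auto simp: k.emeasure_space_1 intro!: mk[OF w] mk[OF w fT])
    also have "\<dots> \<le> 2 * (\<integral>\<^sup>+w. ennreal \<bar>f w - U \<omega>\<bar> \<partial>\<phi> \<omega>)"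
      unfolding mult_2 using d by (intro add_left_mono)
    finally show ?case .
  qed
  also have "\<dots> = 2 * (\<integral>\<^sup>+\<omega>. \<integral>\<^sup>+w. ennreal \<bar>f w - U \<omega>\<bar> \<partial>\<phi> \<omega> \<partial>Q)"
  proof -
    have m[measurable]: "(\<lambda>\<omega>. \<integral>\<^sup>+w. ennreal \<bar>f w - U \<omega>\<bar> \<partial>\<phi> \<omega>) \<in> borel_measurable F"
      by (rule nn_integral_measurable_subprob_algebra2[OF _ ks(2)]) measurable
    show ?thesis by (subst nn_integral_cmult) (auto simp: iQ)
  qed
  also have "(\<integral>\<^sup>+\<omega>. \<integral>\<^sup>+w. ennreal \<bar>f w - U \<omega>\<bar> \<partial>\<phi> \<omega> \<partial>Q) = (\<integral>\<^sup>+\<omega>. ennreal \<bar>f (W \<omega>) - U \<omega>\<bar> \<partial>Q)"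
    using \<phi> by (subst nn_integral_regular_cond_distr[OF \<open>prob_space Q\<close> sub WQ]) auto
  finally show ?thesis .
qed

section \<open>The output filtration: change of law and reliability\<close>

text \<open>An event of the output algebra is a preimage under the tuple of the first
  \<open>n\<close> outputs. The indicator of \<open>W \<in> A\<close> together with \<open>B\<close>
  is thus a measurable function of message and outputs, to which the change of law for integrals
  applies.\<close>

lemma emeasure_change_message_law:
  assumes K: "transition_kernel SX SY K" and e: "encoding_scheme SW SX SY e"
    and P: "feedback_law SW SX SY K e W X Y (density \<mu> f) P"
    and Q: "feedback_law SW SX SY K e W X Y \<mu> Q"
    and sp: "space P = space Q" and f: "f \<in> borel_measurable SW"
    and A: "A \<in> sets SW" and B: "B \<in> sets (output_algebra (space Q) SY Y {1..n})"
  shows "emeasure P (W -` A \<inter> B) = (\<integral>\<^sup>+\<omega>. f (W \<omega>) * indicator A (W \<omega>) * indicator B \<omega> \<partial>Q)"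
proof -
  \<comment> \<open>The half-open range up to \<open>Suc n\<close> covers the outputs
    \<open>1\<close> to \<open>n\<close>, so the earlier result is used at
    \<open>Suc n\<close>.\<close>
  let ?Y = "\<lambda>\<omega>. \<lambda>i\<in>{1..<Suc n}. Y i \<omega>" and ?N = "\<Pi>\<^sub>M i\<in>{1..<Suc n}. SY"
  have WP: "W \<in> P \<rightarrow>\<^sub>M SW" and YP: "\<And>i. i \<ge> 1 \<Longrightarrow> Y i \<in> P \<rightarrow>\<^sub>M SY"
    and YQ: "\<And>i. i \<ge> 1 \<Longrightarrow> Y i \<in> Q \<rightarrow>\<^sub>M SY"
    using P Q by (auto simp: feedback_law_def)
  have Ysp: "Y i \<in> space Q \<rightarrow> space SY" if "i \<ge> 1" for i
    using measurable_space[OF YQ[OF that]] by auto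
  have "?Y \<in> Q \<rightarrow>\<^sub>M ?N" by (intro measurable_restrict YQ) auto
  from measurable_space[OF this] have Ysp': "?Y \<in> space Q \<rightarrow> space ?N" by (rule Pi_I)
  have "Y i \<in> vimage_algebra (space Q) ?Y ?N \<rightarrow>\<^sub>M SY" if i: "i \<in> {1..n}" for i
  proof -
    have "(\<lambda>\<omega>. ?Y \<omega> i) \<in> vimage_algebra (space Q) ?Y ?N \<rightarrow>\<^sub>M SY"
      using i by (intro measurable_compose[OF measurable_vimage_algebra1[OF Ysp']] measurable_component_singleton) auto
    also have "(\<lambda>\<omega>. ?Y \<omega> i) = Y i" using i by auto
    finally show ?thesis .
  qed
  \<comment> \<open>Each \<open>Y i\<close> is a coordinate of the tuple, so the algebra generated
    by the outputs lies inside the preimage algebra of the tuple, whose members have the form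
    required of \<open>B\<close>.\<close>
  then have "sets (output_algebra (space Q) SY Y {1..n}) \<subseteq> sets (vimage_algebra (space Q) ?Y ?N)"
    using Ysp by (intro sets_output_algebra_subset) auto
  with B obtain C where C: "C \<in> sets ?N" "B = ?Y -` C \<inter> space Q"
    unfolding sets_vimage_algebra2[OF Ysp'] by auto
  have "?Y \<in> P \<rightarrow>\<^sub>M ?N" by (intro measurable_restrict YP) auto
  with C have BP: "B \<in> sets P" by (auto simp: sp[symmetric] intro: measurable_sets)
  define g :: "_ \<Rightarrow> ennreal" where "g p = indicator A (fst p) * indicator C (snd p)" for p
  have g: "g \<in> borel_measurable (SW \<Otimes>\<^sub>M ?N)"
    unfolding g_def using A C by measurable
  have "W -` A \<inter> B = (W -` A \<inter> space P) \<inter> B" using C(2) sp by auto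
  then have "W -` A \<inter> B \<in> sets P" using BP measurable_sets[OF WP A] by auto
  then have "emeasure P (W -` A \<inter> B) = (\<integral>\<^sup>+\<omega>. indicator (W -` A \<inter> B) \<omega> \<partial>P)"
    by simp
  also have "\<dots> = (\<integral>\<^sup>+\<omega>. g (W \<omega>, ?Y \<omega>) \<partial>P)"
    by (intro nn_integral_cong) (auto simp: g_def C(2) sp indicator_def)
  also have "\<dots> = (\<integral>\<^sup>+\<omega>. f (W \<omega>) * g (W \<omega>, ?Y \<omega>) \<partial>Q)"
    by (rule nn_integral_change_message_law[OF K e P Q f _ g]) simp
  also have "\<dots> = (\<integral>\<^sup>+\<omega>. f (W \<omega>) * indicator A (W \<omega>) * indicator B \<omega> \<partial>Q)"
    by (intro nn_integral_cong) (auto simp: g_def C(2) indicator_def)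
  finally show ?thesis .
qed

text \<open>Reliability replaces \<open>W\<close> almost surely by a function \<open>U\<close> of
  the entire output sequence. Then \<open>f (U \<omega>)\<close> is integrable on the sigma-algebra
  generated by the finite-time output algebras, and density in \<open>L^1\<close> gives an
  approximant that looks at finitely many outputs.\<close>

lemma reliable_message_approx:
  fixes f :: "'w \<Rightarrow> real"
  assumes "prob_space Q" and W: "W \<in> Q \<rightarrow>\<^sub>M SW" and Y: "\<And>i. 1 \<le> i \<Longrightarrow> Y i \<in> Q \<rightarrow>\<^sub>M SY"
    and rel: "reliable SW SY W Y Q" and f: "f \<in> borel_measurable SW"
    and int: "integrable Q (\<lambda>\<omega>. f (W \<omega>))" and "\<epsilon> > 0"
  obtains n V where "V \<in> borel_measurable (output_algebra (space Q) SY Y {1..n})"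
    "(\<integral>\<^sup>+\<omega>. ennreal \<bar>f (W \<omega>) - V \<omega>\<bar> \<partial>Q) < ennreal \<epsilon>"
proof -
  interpret Q: prob_space Q by fact
  let ?G = "output_algebra (space Q) SY Y"
  have Ysp: "Y i \<in> space Q \<rightarrow> space SY" if "i \<ge> 1" for i
    using measurable_space[OF Y[OF that]] by auto
  have sp: "space (?G I) = space Q" if "I \<subseteq> {1..}" for I
    using Ysp that by (intro space_output_algebra) auto
  have sub: "sets (?G I) \<subseteq> sets Q" if "I \<subseteq> {1..}" for I
    using Ysp Y that by (intro sets_output_algebra_subset) auto
  have sub': "sets (?G I) \<subseteq> sets (?G J)" if "I \<subseteq> J" "J \<subseteq> {1..}" for I J
    using Ysp that by (intro sets_output_algebra_subset sp measurable_output_algebra) auto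
  have subQ: "subalgebra Q (?G {1..})" using sub sp by (simp add: subalgebra_def)
  \<comment> \<open>The approximation result asks for a measure whose sigma-algebra is exactly the
    one generated by the filtration, hence the restriction of \<open>Q\<close> to the output algebra
    of all times.\<close>
  define N where "N = restr_to_subalg Q (?G {1..})"
  have spN: "space N = space Q" by (simp add: N_def space_restr_to_subalg)
  have sN: "sets N = sets (?G {1..})" unfolding N_def by (rule sets_restr_to_subalg[OF subQ])
  have pN: "prob_space N" unfolding N_def by (intro prob_space_restr_to_subalg subQ assms)
  \<comment> \<open>Each generator coming from \<open>Y i\<close> already belongs to the algebra at
    time \<open>i\<close>.\<close>
  have gen: "sets N = sigma_sets (space N) (\<Union>n. sets (?G {1..n}))"
  proof
    have "sets (?G {1..}) = sigma_sets (space Q) (\<Union>i\<in>{1..}. sets (vimage_algebra (space Q) (Y i) SY))"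
      using Ysp by (intro sets_output_algebra) auto
    also have "\<dots> \<subseteq> sigma_sets (space Q) (\<Union>n. sets (?G {1..n}))"
    proof (intro sigma_sets_mono' UN_least)
      fix i :: nat assume i: "i \<in> {1..}"
      have "sets (vimage_algebra (space Q) (Y i) SY) \<subseteq> sets (?G {1..i})"
      proof (subst sets_vimage_algebra_subset_iff)
        show "Y i \<in> space Q \<rightarrow> space SY" "space (?G {1..i}) = space Q"
          using i by (simp_all only: Ysp atLeast_iff) (intro sp, auto)
        show "Y i \<in> ?G {1..i} \<rightarrow>\<^sub>M SY"
          by (rule measurable_output_algebra) (use i in \<open>simp_all only: Ysp atLeast_iff atLeastAtMost_iff order_refl\<close>)
      qed
      then show "sets (vimage_algebra (space Q) (Y i) SY) \<subseteq> (\<Union>n. sets (?G {1..n}))" by blast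
    qed
    finally show "sets N \<subseteq> sigma_sets (space N) (\<Union>n. sets (?G {1..n}))" by (simp add: sN spN)
    have "(\<Union>n. sets (?G {1..n})) \<subseteq> sets N"
      unfolding sN by (intro UN_least sub') auto
    then show "sigma_sets (space N) (\<Union>n. sets (?G {1..n})) \<subseteq> sets N" by (rule sets.sigma_sets_subset)
  qed
  obtain U where U: "U \<in> ?G {1..} \<rightarrow>\<^sub>M SW" and WU: "AE \<omega> in Q. W \<omega> = U \<omega>"
    using rel unfolding reliable_def by (elim bexE)
  have fU: "(\<lambda>\<omega>. f (U \<omega>)) \<in> borel_measurable (?G {1..})" using U f by (rule measurable_compose)
  have fUQ: "(\<lambda>\<omega>. f (U \<omega>)) \<in> borel_measurable Q" by (rule measurable_from_subalg[OF subQ fU])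
  have fWQ: "(\<lambda>\<omega>. f (W \<omega>)) \<in> borel_measurable Q" using W f by (rule measurable_compose)
  have "AE \<omega> in Q. f (W \<omega>) = f (U \<omega>)" using WU by eventually_elim simp
  with int have "integrable Q (\<lambda>\<omega>. f (U \<omega>))"
    using integrable_cong_AE[OF fWQ fUQ] by simp
  then have intN: "integrable N (\<lambda>\<omega>. f (U \<omega>))"
    unfolding N_def by (intro integrable_in_subalg subQ fU)
  have subN: "subalgebra N (?G {1..n})" for n
    using sub'[of "{1..n}" "{1..}"] sp[of "{1..n}"] by (auto simp: subalgebra_def spN sN)
  have mono: "sets (?G {1..m}) \<subseteq> sets (?G {1..n})" if "m \<le> n" for m n
    using that by (intro sub') auto
  obtain n V where V: "V \<in> borel_measurable (?G {1..n})" "integrable N V"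
      "(LINT x|N. \<bar>f (U x) - V x\<bar>) < \<epsilon>"
    using integrable_filtration_approx[where F="\<lambda>n. ?G {1..n}", OF pN subN mono gen intN \<open>\<epsilon> > 0\<close>] by auto
  have "(\<integral>\<^sup>+\<omega>. ennreal \<bar>f (W \<omega>) - V \<omega>\<bar> \<partial>Q) = (\<integral>\<^sup>+\<omega>. ennreal \<bar>f (U \<omega>) - V \<omega>\<bar> \<partial>Q)"
    using WU by (intro nn_integral_cong_AE) auto
  also have "\<dots> = (\<integral>\<^sup>+\<omega>. ennreal \<bar>f (U \<omega>) - V \<omega>\<bar> \<partial>N)"
    unfolding N_def
  proof (rule nn_integral_subalgebra2[OF subQ, symmetric])
    have "V \<in> borel_measurable N" using V(2) by (rule borel_measurable_integrable)
    then have "V \<in> borel_measurable (?G {1..})" by (subst measurable_cong_sets[OF sN[symmetric] refl])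
    then show "(\<lambda>\<omega>. ennreal \<bar>f (U \<omega>) - V \<omega>\<bar>) \<in> borel_measurable (?G {1..})"
      using fU by measurable
  qed
  also have "\<dots> = ennreal (LINT x|N. \<bar>f (U x) - V x\<bar>)"
    using V(2) intN by (intro nn_integral_eq_integral) auto
  also have "\<dots> < ennreal \<epsilon>" using V(3) \<open>\<epsilon> > 0\<close> by (intro ennreal_lessI)
  finally show ?thesis using that V(1) by blast
qed

section \<open>Convergence of the posteriors\<close>

theorem theorem3p7:
  fixes \<W> \<X> :: "'a::euclidean_space set" and \<Y> :: "'b::euclidean_space set"
    and K :: "'a \<Rightarrow> 'b measure"
    and e :: "nat \<Rightarrow> 'a \<times> (nat \<Rightarrow> 'b) \<Rightarrow> 'a"
    and Pbar P :: "'o measure"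
    and W :: "'o \<Rightarrow> 'a" and X :: "nat \<Rightarrow> 'o \<Rightarrow> 'a" and Y :: "nat \<Rightarrow> 'o \<Rightarrow> 'b"
    and \<nu> :: "'a measure"
    and \<psi> \<psi>bar :: "nat \<Rightarrow> 'o \<Rightarrow> 'a measure"
  assumes "open \<W>" and "bounded \<W>" and "convex \<W>"
    and "transition_kernel (borel_on \<X>) (borel_on \<Y>) K"
    and "encoding_scheme (borel_on \<W>) (borel_on \<X>) (borel_on \<Y>) e"
    and "sets P = sets Pbar"
    and "feedback_law (borel_on \<W>) (borel_on \<X>) (borel_on \<Y>) K e W X Y (uniform_on \<W>) Pbar"
    and "reliable (borel_on \<W>) (borel_on \<Y>) W Y Pbar"
    and "prob_space \<nu>" and "sets \<nu> = sets (borel_on \<W>)"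
    and "absolutely_continuous (uniform_on \<W>) \<nu>"
    and "feedback_law (borel_on \<W>) (borel_on \<X>) (borel_on \<Y>) K e W X Y \<nu> P"
    and "\<And>n. n \<ge> 1 \<Longrightarrow> posterior (borel_on \<W>) (borel_on \<Y>) W Y P n (\<psi> n)"
    and "\<And>n. n \<ge> 1 \<Longrightarrow> posterior (borel_on \<W>) (borel_on \<Y>) W Y Pbar n (\<psi>bar n)"
  shows "(\<lambda>n. prob_space.expectation P (\<lambda>\<omega>. tv_dist (\<psi> n \<omega>) (\<psi>bar n \<omega>))) \<longlonglongrightarrow> 0"
proof -
  have law: "feedback_law (borel_on \<W>) (borel_on \<X>) (borel_on \<Y>) K e W X Y (uniform_on \<W>) Pbar"
    and lawP: "feedback_law (borel_on \<W>) (borel_on \<X>) (borel_on \<Y>) K e W X Y \<nu> P"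
    and sets: "sets P = sets Pbar" by fact+
  have "prob_space P" "prob_space Pbar" and W: "W \<in> Pbar \<rightarrow>\<^sub>M borel_on \<W>"
    and Y: "\<And>i. i \<ge> 1 \<Longrightarrow> Y i \<in> Pbar \<rightarrow>\<^sub>M borel_on \<Y>"
    and dist: "distr Pbar (borel_on \<W>) W = uniform_on \<W>"
    using law lawP by (auto simp: feedback_law_def)
  have sp: "space P = space Pbar" using sets by (rule sets_eq_imp_space_eq)
  \<comment> \<open>The uniform distribution is a probability measure because it is the law of
    \<open>W\<close> under \<open>Pbar\<close>.\<close>
  interpret u: prob_space "uniform_on \<W>"
    unfolding dist[symmetric] by (rule prob_space.prob_space_distr[OF \<open>prob_space Pbar\<close> W])
  have su: "sets (uniform_on \<W>) = sets (borel_on \<W>)" unfolding dist[symmetric] by simp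
  have fin\<nu>: "finite_measure \<nu>" using \<open>prob_space \<nu>\<close> by (rule prob_space.finite_measure)
  have s\<nu>: "sets \<nu> = sets (uniform_on \<W>)" using \<open>sets \<nu> = sets (borel_on \<W>)\<close> su by simp
  \<comment> \<open>Radon-Nikodym supplies a density that is real-valued and nonnegative everywhere,
    as the posterior estimate requires.\<close>
  obtain f where fu: "f \<in> borel_measurable (uniform_on \<W>)" and
    RN: "AE x in uniform_on \<W>. RN_deriv (uniform_on \<W>) \<nu> x = ennreal (f x)" and f0: "\<And>x. 0 \<le> f x"
    using u.real_RN_deriv[OF fin\<nu> \<open>absolutely_continuous (uniform_on \<W>) \<nu>\<close> s\<nu>] by metis
  have f: "f \<in> borel_measurable (borel_on \<W>)" using fu by (simp cong: measurable_cong_sets add: su)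
  have "density (uniform_on \<W>) (RN_deriv (uniform_on \<W>) \<nu>) = density (uniform_on \<W>) (\<lambda>x. ennreal (f x))"
    using RN fu by (intro density_cong) auto
  then have \<nu>: "\<nu> = density (uniform_on \<W>) (\<lambda>x. ennreal (f x))"
    using u.density_RN_deriv[OF \<open>absolutely_continuous (uniform_on \<W>) \<nu>\<close> s\<nu>] by simp
  have "integrable (uniform_on \<W>) f"
  proof (rule integrableI_nonneg)
    have "(\<integral>\<^sup>+x. ennreal (f x) \<partial>uniform_on \<W>) = emeasure \<nu> (space \<nu>)"
      unfolding \<nu> using fu by (subst emeasure_density) (auto intro!: nn_integral_cong)
    then show "(\<integral>\<^sup>+x. ennreal (f x) \<partial>uniform_on \<W>) < \<infinity>"
      using prob_space.emeasure_space_1[OF \<open>prob_space \<nu>\<close>] by simp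
  qed (use fu f0 in auto)
  then have int: "integrable Pbar (\<lambda>\<omega>. f (W \<omega>))"
    unfolding dist[symmetric] using W f by (subst (asm) integrable_distr_eq) auto
  let ?F = "\<lambda>n. output_algebra (space Pbar) (borel_on \<Y>) Y {1..n}"
  have Ysp: "Y i \<in> space Pbar \<rightarrow> space (borel_on \<Y>)" if "i \<ge> 1" for i
    using measurable_space[OF Y[OF that]] by auto
  have subF: "subalgebra Pbar (?F n)" for n
    unfolding subalgebra_def using Ysp Y by (intro conjI space_output_algebra sets_output_algebra_subset) auto
  have spF: "space (?F n) = space Pbar" for n using subF by (simp add: subalgebra_def)
  \<comment> \<open>An approximant found at one time stays measurable at all later times, so a
    single \<open>U\<close> controls the whole tail of the sequence.\<close>
  have mono: "subalgebra (?F n) (?F m)" if "m \<le> n" for m n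
  proof -
    have "sets (?F m) \<subseteq> sets (?F n)"
    proof (rule sets_output_algebra_subset)
      show "Y i \<in> space Pbar \<rightarrow> space (borel_on \<Y>)" if "i \<in> {1..m}" for i
        using that by (intro Ysp) simp
      show "Y i \<in> ?F n \<rightarrow>\<^sub>M borel_on \<Y>" if "i \<in> {1..m}" for i
        using that \<open>m \<le> n\<close> by (intro measurable_output_algebra Ysp) auto
    qed (rule spF)
    then show ?thesis unfolding subalgebra_def spF by simp
  qed
  have bound: "ennreal (LINT \<omega>|P. tv_dist (\<psi> n \<omega>) (\<psi>bar n \<omega>))
      \<le> 2 * (\<integral>\<^sup>+\<omega>. ennreal \<bar>f (W \<omega>) - U \<omega>\<bar> \<partial>Pbar)"
    if "n \<ge> 1" and U: "U \<in> borel_measurable (?F n)" for n U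
  proof (rule expectation_tv_dist_posterior_le[OF \<open>prob_space P\<close> \<open>prob_space Pbar\<close> sets subF _ W f f0 _ _ _ U])
    show "\<W> \<in> sets borel" using \<open>open \<W>\<close> by simp
    show "regular_cond_distr P (?F n) W (borel_on \<W>) (\<psi> n)"
      and "regular_cond_distr Pbar (?F n) W (borel_on \<W>) (\<psi>bar n)"
      using assms(13,14)[OF \<open>n \<ge> 1\<close>] by (simp_all add: posterior_def sp)
    show "emeasure P (W -` A \<inter> B) = (\<integral>\<^sup>+\<omega>. ennreal (f (W \<omega>)) * indicator A (W \<omega>) * indicator B \<omega> \<partial>Pbar)"
      if "A \<in> sets (borel_on \<W>)" "B \<in> sets (?F n)" for A B
    proof (rule emeasure_change_message_law[OF assms(4,5) lawP[unfolded \<nu>] law sp _ that])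
      show "(\<lambda>x. ennreal (f x)) \<in> borel_measurable (borel_on \<W>)" using f by simp
    qed
  qed
  show ?thesis
  proof (rule LIMSEQ_I)
    fix r :: real assume "r > 0"
    then have "r / 2 > 0" by simp
    \<comment> \<open>The accuracy \<open>r / 2\<close> absorbs the factor 2 in
      \<open>bound\<close>.\<close>
    obtain m U where U: "U \<in> borel_measurable (?F m)"
      and less: "(\<integral>\<^sup>+\<omega>. ennreal \<bar>f (W \<omega>) - U \<omega>\<bar> \<partial>Pbar) < ennreal (r / 2)"
      by (rule reliable_message_approx[OF \<open>prob_space Pbar\<close> W Y assms(8) f int \<open>r / 2 > 0\<close>])
    show "\<exists>m. \<forall>n\<ge>m. norm ((LINT \<omega>|P. tv_dist (\<psi> n \<omega>) (\<psi>bar n \<omega>)) - 0) < r"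
    proof (intro exI allI impI)
      \<comment> \<open>The posteriors are given from time 1 on, hence the maximum with 1.\<close>
      fix n assume n: "max 1 m \<le> n"
      let ?I = "LINT \<omega>|P. tv_dist (\<psi> n \<omega>) (\<psi>bar n \<omega>)"
      have "U \<in> borel_measurable (?F n)" using n by (intro measurable_from_subalg[OF mono U]) simp
      then have "ennreal ?I \<le> 2 * (\<integral>\<^sup>+\<omega>. ennreal \<bar>f (W \<omega>) - U \<omega>\<bar> \<partial>Pbar)"
        using n by (intro bound) auto
      also have "\<dots> < 2 * ennreal (r / 2)"
        using less by (intro ennreal_mult_strict_left_mono) auto
      also have "\<dots> = ennreal r"
        unfolding mult_2 using \<open>r > 0\<close> by (subst ennreal_plus[symmetric]) simp_all
      finally have less_r: "ennreal ?I < ennreal r" .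
      have "?I < r"
      proof (rule ccontr)
        assume "\<not> ?I < r"
        then have "ennreal r \<le> ennreal ?I" by (intro ennreal_leI) simp
        with less_r show False by (rule leD[THEN notE, rotated])
      qed
      \<comment> \<open>\<open>ennreal\<close> sends negative reals to 0, so the bound above
        controls \<open>?I\<close> only from above; the norm requires the sign as well.\<close>
      moreover have "0 \<le> ?I"
      proof (rule integral_nonneg_AE, rule AE_I2)
        fix \<omega> assume "\<omega> \<in> space P"
        then have w: "\<omega> \<in> space (?F n)" using subF[of n] sp by (simp add: subalgebra_def)
        have "\<psi> n \<in> ?F n \<rightarrow>\<^sub>M prob_algebra (borel_on \<W>)" "\<psi>bar n \<in> ?F n \<rightarrow>\<^sub>M prob_algebra (borel_on \<W>)"
          using assms(13,14)[of n] n
          by (simp_all add: posterior_def regular_cond_distr_def transition_kernel_def sp)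
        from this[THEN measurable_space, OF w] show "0 \<le> tv_dist (\<psi> n \<omega>) (\<psi>bar n \<omega>)"
          by (intro tv_dist_nonneg) (simp_all add: space_prob_algebra)
      qed
      ultimately show "norm (?I - 0) < r" by simp
    qed
  qed
qed

end
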